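(* There is no finite group $G$ that has exactly $35$ Sylow $17$-subgroups.
   Context: For a finite group $G$ of order $p^a m$, where $p$ is a prime not dividing $m$ and $a\ge 0$, a Sylow $p$-subgroup of $G$ is a subgroup of order $p^a$ (if $p$ does not divide $|G|$, the trivial subgroup is the unique Sylow $p$-subgroup). *)

theory Defs
  imports "HOL-Algebra.Algebra" "HOL-Computational_Algebra.Primes"
begin

text \<open>
  Intended for a finite group \<open>G\<close> and a prime \<open>p\<close>; the exponent \<open>a\<close> is then unique.
  The case \<open>a = 0\<close> is allowed: if \<open>p\<close> does not divide \<open>order G\<close>, the trivial subgroup
  is the only Sylow \<open>p\<close>-subgroup.
\<close>

definition sylow_subgroup :: "nat \<Rightarrow> 'a set \<Rightarrow> ('a, 'b) monoid_scheme \<Rightarrow> bool" where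
  "sylow_subgroup p H G \<longleftrightarrow> subgroup H G \<and>
     (\<exists>a m. order G = p ^ a * m \<and> \<not> p dvd m \<and> card H = p ^ a)"

end

theory Submission
  imports Defs "HOL-Combinatorics.Permutations" "HOL-Number_Theory.Residues"
begin

text \<open>
  Let \<open>G\<close> act by conjugation on its 35 Sylow 17-subgroups, and let \<open>\<Gamma>\<close> be the group of even
  permutations so induced; it contains the image of every Sylow subgroup \<open>P\<close>. Such a \<open>P\<close> fixes only
  the point \<open>P\<close> and has two further orbits of length 17. Two distinct images meet trivially: otherwise
  the fixed-point sets of the intersections would be lines with 18 points of a linear space on 35
  points. So they have order 17. An involution of \<open>\<Gamma>\<close> has a fixed point \<open>P\<close>; being even, it cannot
  swap the two orbits of \<open>P\<close>, hence it inverts \<open>P\<close> and has exactly 3 fixed points, and there are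
  exactly 17 involutions fixing \<open>P\<close>. Counting pairs of an involution and a fixed point, 3 would divide
  \<open>35 \<cdot> 17\<close>; so \<open>\<Gamma>\<close> has odd order. Then point stabilizers have order 17 and \<open>\<Gamma>\<close> has order 595. It has
  \<open>35 \<cdot> 16 = 560\<close> elements of order 17, while the numbers of elements of order 5 and 7 are positive and
  divisible by 34, which is too much.
\<close>

section \<open>Actions of finite groups\<close>

text \<open>Values of \<open>\<phi> g\<close> outside \<open>S\<close> are left free, so that one
  \<open>\<phi>\<close> can act on several sets; \<open>group_action\<close> wants functions
  restricted to \<open>S\<close>.\<close>

definition acts_on :: "('g, 'b) monoid_scheme \<Rightarrow> ('g \<Rightarrow> 'x \<Rightarrow> 'x) \<Rightarrow> 'x set \<Rightarrow> bool" where
  "acts_on G \<phi> S \<longleftrightarrow> group G \<and> (\<forall>g\<in>carrier G. \<forall>x\<in>S. \<phi> g x \<in> S) \<and>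
     (\<forall>x\<in>S. \<phi> \<one>\<^bsub>G\<^esub> x = x) \<and>
     (\<forall>g\<in>carrier G. \<forall>h\<in>carrier G. \<forall>x\<in>S. \<phi> (g \<otimes>\<^bsub>G\<^esub> h) x = \<phi> g (\<phi> h x))"

lemma acts_on_group_action:
  assumes "acts_on G \<phi> S"
  shows "group_action G S (\<lambda>g. restrict (\<phi> g) S)"
proof -
  interpret group G using assms by (simp add: acts_on_def)
  have cl: "\<And>g x. g \<in> carrier G \<Longrightarrow> x \<in> S \<Longrightarrow> \<phi> g x \<in> S"
    and one: "\<And>x. x \<in> S \<Longrightarrow> \<phi> \<one>\<^bsub>G\<^esub> x = x"
    and mul: "\<And>g h x. g \<in> carrier G \<Longrightarrow> h \<in> carrier G \<Longrightarrow> x \<in> S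
       \<Longrightarrow> \<phi> (g \<otimes>\<^bsub>G\<^esub> h) x = \<phi> g (\<phi> h x)"
    using assms by (auto simp: acts_on_def)
  have bij: "restrict (\<phi> g) S \<in> Bij S" if g: "g \<in> carrier G" for g
  proof -
    have "bij_betw (\<phi> g) S S"
      by (rule bij_betw_byWitness[where f' = "\<phi> (inv\<^bsub>G\<^esub> g)"])
        (use g cl in \<open>auto simp flip: mul simp: one\<close>)
    then show ?thesis by (simp add: Bij_def)
  qed
  show ?thesis
    unfolding group_action_def group_hom_def group_hom_axioms_def hom_def
    by (auto simp: is_group group_BijGroup) (auto simp: BijGroup_def bij mul cl compose_def fun_eq_iff)
qed

lemma acts_on_subset:
  assumes "acts_on G \<phi> S" "T \<subseteq> S" "\<And>g x. g \<in> carrier G \<Longrightarrow> x \<in> T \<Longrightarrow> \<phi> g x \<in> T"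
  shows "acts_on G \<phi> T"
  using assms unfolding acts_on_def by blast

lemma orbit_stabilizer:
  assumes "acts_on G \<phi> S" "x \<in> S"
  shows "card ((\<lambda>g. \<phi> g x) ` carrier G) * card {g \<in> carrier G. \<phi> g x = x} = order G"
proof -
  interpret group_action G S "\<lambda>g. restrict (\<phi> g) S"
    by (rule acts_on_group_action) (fact assms)
  have "orbit G (\<lambda>g. restrict (\<phi> g) S) x = (\<lambda>g. \<phi> g x) ` carrier G"
    using assms(2) by (auto simp: orbit_def)
  moreover have "stabilizer G (\<lambda>g. restrict (\<phi> g) S) x = {g \<in> carrier G. \<phi> g x = x}"
    using assms(2) by (auto simp: stabilizer_def)
  ultimately show ?thesis using orbit_stabilizer_theorem[OF assms(2)] by simp
qed

text \<open>The orbit size divides \<open>p ^ k\<close>, and it is at least 2 because the orbit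
  contains both \<open>x\<close> and \<open>\<phi> g x\<close>.\<close>

lemma p_group_card_orbit:
  assumes "acts_on G \<phi> S" "x \<in> S" "Factorial_Ring.prime p" "order G = p ^ k"
    and "g \<in> carrier G" "\<phi> g x \<noteq> x"
  shows "\<exists>i>0. card ((\<lambda>g. \<phi> g x) ` carrier G) = p ^ i"
proof -
  let ?O = "(\<lambda>g. \<phi> g x) ` carrier G"
  have "order G > 0" using assms by (simp add: prime_gt_0_nat)
  then have fin: "finite (carrier G)" unfolding order_def by (simp add: card_gt_0_iff)
  have "card ?O dvd p ^ k" using orbit_stabilizer[OF assms(1,2)] assms(4) by (metis dvd_triv_left)
  then obtain i where i: "card ?O = p ^ i" using assms(3) divides_primepow_nat by blast
  interpret group G using assms(1) by (simp add: acts_on_def)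
  have "x \<in> ?O"
    using assms(1,2) by (auto simp: acts_on_def intro!: image_eqI[where x = "\<one>\<^bsub>G\<^esub>"])
  then have "{x, \<phi> g x} \<subseteq> ?O" using assms by auto
  then have "card {x, \<phi> g x} \<le> card ?O" using fin by (intro card_mono) auto
  then have "i \<noteq> 0" using i assms(6) by (intro notI) auto
  then show ?thesis using i by auto
qed

text \<open>Orbits partition \<open>S\<close>, and without fixed points each of them has size a
  positive power of \<open>p\<close>.\<close>

lemma p_group_dvd_card:
  assumes "acts_on G \<phi> S" "finite S" "Factorial_Ring.prime p" "order G = p ^ k"
    and nofix: "\<And>x. x \<in> S \<Longrightarrow> \<exists>g\<in>carrier G. \<phi> g x \<noteq> x"
  shows "p dvd card S"
proof -
  interpret group_action G S "\<lambda>g. restrict (\<phi> g) S"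
    by (rule acts_on_group_action) (fact assms)
  let ?O = "orbits G S (\<lambda>g. restrict (\<phi> g) S)"
  have orb: "orbit G (\<lambda>g. restrict (\<phi> g) S) x = (\<lambda>g. \<phi> g x) ` carrier G" if "x \<in> S" for x
    using that by (auto simp: orbit_def)
  have dvd: "p dvd card A" if "A \<in> ?O" for A
  proof -
    from that obtain x where x: "x \<in> S" "A = (\<lambda>g. \<phi> g x) ` carrier G"
      unfolding orbits_def using orb by auto
    obtain g where "g \<in> carrier G" "\<phi> g x \<noteq> x" using nofix x(1) by blast
    from p_group_card_orbit[OF assms(1) x(1) assms(3,4) this] show ?thesis
      unfolding x(2) by (auto intro: dvd_power)
  qed
  have "card S = (\<Sum>A\<in>?O. card A)"
    using disjoint_sum[OF assms(2), of "\<lambda>_. 1 :: nat"] by simp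
  then show ?thesis using dvd by (simp add: dvd_sum)
qed

lemma (in group) Cauchy:
  assumes "finite (carrier G)" "Factorial_Ring.prime p" "p dvd order G"
  shows "\<exists>g\<in>carrier G. g \<noteq> \<one> \<and> g [^] p = \<one>"
proof -
  \<comment> \<open>Sylow's theorem yields a subgroup for each power of \<open>p\<close> dividing
    the order; exponent 1 gives one of order \<open>p\<close>.\<close>
  from assms(3) obtain m where "order G = p ^ 1 * m" by auto
  then obtain H where H: "subgroup H G" "card H = p"
    using sylow_thm[OF assms(2) is_group _ assms(1)] by (metis power_one_right)
  then have "card H > 1" using assms(2) prime_gt_1_nat by simp
  then obtain g where g: "g \<in> H" "g \<noteq> \<one>"
    by (metis One_nat_def card_1_singleton_iff card.empty is_singletonI' is_singleton_altdef less_irrefl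
        less_one not_less_zero)
  interpret H: group "G\<lparr>carrier := H\<rparr>" using H(1) by (rule subgroup.subgroup_is_group) (rule is_group)
  have "g [^] p = \<one>"
    using H.pow_order_eq_1[of g] g H by (simp add: order_def nat_pow_consistent[symmetric])
  then show ?thesis using g H(1) by (auto dest: subgroup.mem_carrier)
qed

section \<open>Permutation groups\<close>

lemma even_card_not_fixed:
  assumes "finite S" "\<And>x. x \<in> S \<Longrightarrow> f x \<in> S" "\<And>x. x \<in> S \<Longrightarrow> f (f x) = x"
  shows "even (card {x \<in> S. f x \<noteq> x})"
  using assms
proof (induction "card S" arbitrary: S rule: less_induct)
  case less
  show ?case
  proof (cases "\<exists>x\<in>S. f x \<noteq> x")
    case True
    then obtain x where x: "x \<in> S" "f x \<noteq> x" by blast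
    \<comment> \<open>Removing one 2-cycle lowers the number of moved points by 2.\<close>
    let ?T = "S - {x, f x}"
    have "card ?T < card S" using x less.prems(1) by (intro psubset_card_mono) auto
    moreover have "f y \<in> ?T" if "y \<in> ?T" for y
      using that less.prems x by (metis Diff_iff insert_iff singletonD)
    ultimately have ev: "even (card {y \<in> ?T. f y \<noteq> y})"
      using less.prems by (intro less.hyps) auto
    have "{y \<in> S. f y \<noteq> y} = insert x (insert (f x) {y \<in> ?T. f y \<noteq> y})"
      using x less.prems by auto
    then have "card {y \<in> S. f y \<noteq> y} = Suc (Suc (card {y \<in> ?T. f y \<noteq> y}))"
      using x less.prems(1) by auto
    then show ?thesis using ev by simp
  next
    case False
    then have "{x \<in> S. f x \<noteq> x} = {}" by blast
    then show ?thesis by (simp only: card.empty even_zero)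
  qed
qed

text \<open>The moved points form 2-cycles, so \<open>t\<close> is a product of half as many
  transpositions; the induction splits off one of them.\<close>

lemma sign_involution:
  assumes "finite S" "t permutes S" "t \<circ> t = id"
  shows "sign t = (- 1) ^ (card {x. t x \<noteq> x} div 2)"
  using assms
proof (induction "card S" arbitrary: S t rule: less_induct)
  case less
  have tt: "t (t x) = x" for x using less.prems(3) by (metis comp_apply id_apply)
  show ?case
  proof (cases "\<exists>x. t x \<noteq> x")
    case True
    then obtain x where x: "t x \<noteq> x" by blast
    then have xS: "x \<in> S" "t x \<in> S"
      using less.prems(2) by (auto simp: permutes_def permutes_in_image)
    \<comment> \<open>\<open>u\<close> is \<open>t\<close> with the 2-cycle through \<open>x\<close>
      cancelled: it fixes \<open>x\<close> and \<open>t x\<close> and agrees with \<open>t\<close>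
      elsewhere.\<close>
    define u where "u = transpose x (t x) \<circ> t"
    let ?T = "S - {x, t x}"
    have u: "u y = (if y = x \<or> y = t x then y else t y)" for y
      by (auto simp: u_def transpose_def tt) (metis tt)+
    have uS: "u permutes S"
      unfolding u_def by (intro permutes_compose less.prems permutes_swap_id xS)
    have uT: "u permutes ?T"
      by (rule permutes_superset[OF uS]) (auto simp: u)
    have uu: "u \<circ> u = id"
      using tt by (auto simp: fun_eq_iff u) metis+
    have fin: "finite {y. u y \<noteq> y}"
      by (rule finite_subset[of _ S]) (use uS less.prems(1) in \<open>auto simp: permutes_def\<close>)
    have "card ?T < card S" using xS less.prems(1) by (intro psubset_card_mono) auto
    from less.hyps[OF this _ uT uu] less.prems(1)
    have su: "sign u = (- 1) ^ (card {y. u y \<noteq> y} div 2)" by simp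
    have "{y. t y \<noteq> y} = insert x (insert (t x) {y. u y \<noteq> y})"
      using x by (auto simp: u tt)
    then have "card {y. t y \<noteq> y} = Suc (Suc (card {y. u y \<noteq> y}))"
      using x fin by (auto simp: u)
    moreover have "t = transpose x (t x) \<circ> u"
      by (auto simp: u_def fun_eq_iff)
    then have "sign t = sign (transpose x (t x)) * sign u"
      by (metis less.prems(1) permutation_permutes permutation_swap_id sign_compose uS)
    ultimately show ?thesis using su x by (simp add: sign_swap_id)
  next
    case False
    then have "t = id" by auto
    then show ?thesis by simp
  qed
qed

section \<open>Permutation groups and their translation to abstract groups\<close>

definition perm_monoid :: "('a \<Rightarrow> 'a) set \<Rightarrow> ('a \<Rightarrow> 'a) monoid" where
  "perm_monoid \<Gamma> = \<lparr>carrier = \<Gamma>, monoid.mult = (\<circ>), one = id\<rparr>"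

lemma perm_monoid_simps [simp]:
  "carrier (perm_monoid \<Gamma>) = \<Gamma>" "f \<otimes>\<^bsub>perm_monoid \<Gamma>\<^esub> g = f \<circ> g" "\<one>\<^bsub>perm_monoid \<Gamma>\<^esub> = id"
  "order (perm_monoid \<Gamma>) = card \<Gamma>"
  by (auto simp: perm_monoid_def order_def)

lemma perm_monoid_pow [simp]: "f [^]\<^bsub>perm_monoid \<Gamma>\<^esub> (n::nat) = f ^^ n"
  by (induction n) (auto simp: nat_pow_def perm_monoid_def funpow_swap1)

text \<open>A function that \<open>permutes\<close> a set is a bijection of the whole type, hence
  the inverse on \<open>UNIV\<close>.\<close>

abbreviation perm_inv :: "('a \<Rightarrow> 'a) \<Rightarrow> 'a \<Rightarrow> 'a" where
  "perm_inv \<equiv> inv_into UNIV"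

locale perm_group =
  fixes \<Omega> :: "'a set" and \<Gamma> :: "('a \<Rightarrow> 'a) set"
  assumes finite_points: "finite \<Omega>"
    and permutes: "g \<in> \<Gamma> \<Longrightarrow> g permutes \<Omega>"
    and id_mem [simp]: "id \<in> \<Gamma>"
    and comp_mem: "g \<in> \<Gamma> \<Longrightarrow> h \<in> \<Gamma> \<Longrightarrow> g \<circ> h \<in> \<Gamma>"
    and inv_mem: "g \<in> \<Gamma> \<Longrightarrow> perm_inv g \<in> \<Gamma>"
begin

lemma bij: "g \<in> \<Gamma> \<Longrightarrow> bij g"
  using permutes permutes_bij by blast

lemma inv_apply [simp]: "g \<in> \<Gamma> \<Longrightarrow> perm_inv g (g x) = x" "g \<in> \<Gamma> \<Longrightarrow> g (perm_inv g x) = x"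
  using bij by (simp_all add: bij_is_inj bij_inv_eq_iff bij_is_surj surj_f_inv_f)

lemma inv_comp [simp]: "g \<in> \<Gamma> \<Longrightarrow> perm_inv g \<circ> g = id" "g \<in> \<Gamma> \<Longrightarrow> g \<circ> perm_inv g = id"
  by auto

lemma apply_eq_iff [simp]: "g \<in> \<Gamma> \<Longrightarrow> g x = g y \<longleftrightarrow> x = y"
  by (metis inv_apply(1))

lemma apply_mem [simp]: "g \<in> \<Gamma> \<Longrightarrow> g x \<in> \<Omega> \<longleftrightarrow> x \<in> \<Omega>"
  using permutes permutes_in_image by metis

lemma apply_outside: "g \<in> \<Gamma> \<Longrightarrow> x \<notin> \<Omega> \<Longrightarrow> g x = x"
  using permutes permutes_not_in by metis

lemma perm_eqI:
  assumes "g \<in> \<Gamma>" "h \<in> \<Gamma>" "\<And>x. x \<in> \<Omega> \<Longrightarrow> g x = h x"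
  shows "g = h"
  using assms apply_outside by (metis ext)

lemma finite_group: "finite \<Gamma>"
  by (rule finite_subset[of _ "{p. p permutes \<Omega>}"])
    (use permutes finite_points in \<open>auto intro: finite_permutations\<close>)

lemma card_pos [simp]: "card \<Gamma> > 0"
  using finite_group by (metis card_gt_0_iff empty_iff id_mem)

lemma group: "group (perm_monoid \<Gamma>)"
  by (rule groupI) (auto simp: comp_mem comp_assoc intro: inv_mem inv_comp)

lemma funpow_mem: "g \<in> \<Gamma> \<Longrightarrow> g ^^ n \<in> \<Gamma>"
  by (induction n) (auto simp: comp_mem)

lemma funpow_card: "g \<in> \<Gamma> \<Longrightarrow> g ^^ card \<Gamma> = id"
  using group.pow_order_eq_1[OF group, of g] by simp

lemma acts: "acts_on (perm_monoid \<Gamma>) (\<lambda>g. g) \<Omega>"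
  using group by (auto simp: acts_on_def)

lemma card_orbit_stabilizer:
  "x \<in> \<Omega> \<Longrightarrow> card ((\<lambda>g. g x) ` \<Gamma>) * card {g \<in> \<Gamma>. g x = x} = card \<Gamma>"
  using orbit_stabilizer[OF acts] by simp

lemma Cauchy:
  assumes "Factorial_Ring.prime p" "p dvd card \<Gamma>"
  shows "\<exists>g\<in>\<Gamma>. g \<noteq> id \<and> g ^^ p = id"
  using group.Cauchy[OF group, of p] finite_group assms by simp

text \<open>The order of \<open>g\<close> divides both \<open>m\<close> and \<open>n\<close>, so it
  is 1.\<close>

lemma funpow_coprime:
  assumes "g \<in> \<Gamma>" "g ^^ m = id" "g ^^ n = id" "coprime m n"
  shows "g = id"
proof -
  interpret group "perm_monoid \<Gamma>" by (rule group)
  have "ord g dvd m" "ord g dvd n" using assms pow_eq_id[of g] by auto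
  then have "ord g = 1" using assms(4) by (metis coprime_common_divisor_nat)
  then show ?thesis using ord_eq_1[of g] assms(1) by simp
qed

lemma subgroup_card_dvd:
  assumes "perm_group \<Omega> \<Delta>" "\<Delta> \<subseteq> \<Gamma>"
  shows "card \<Delta> dvd card \<Gamma>"
proof -
  interpret D: perm_group \<Omega> \<Delta> by fact
  interpret group "perm_monoid \<Gamma>" by (rule group)
  have "subgroup \<Delta> (perm_monoid \<Gamma>)"
  proof (rule subgroupI)
    fix a assume "a \<in> \<Delta>"
    then have "inv\<^bsub>perm_monoid \<Gamma>\<^esub> a = perm_inv a"
      by (intro inv_equality) (use assms D.inv_mem D.inv_comp in auto)
    then show "inv\<^bsub>perm_monoid \<Gamma>\<^esub> a \<in> \<Delta>" using \<open>a \<in> \<Delta>\<close> D.inv_mem by simp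
  next
    show "\<Delta> \<noteq> {}" using D.id_mem by blast
  qed (use assms D.comp_mem in auto)
  from lagrange[OF this] show ?thesis by (metis dvd_triv_right perm_monoid_simps(4))
qed

lemma p_group_funpow:
  assumes "card \<Gamma> = p ^ k" "g \<in> \<Gamma>"
  shows "g ^^ (p ^ k) = id"
  using funpow_card assms by metis

text \<open>The order of \<open>x\<close> divides a prime and is not 1, so the distinct powers of
  \<open>x\<close> already number \<open>card \<Gamma>\<close>.\<close>

lemma prime_order_generator:
  assumes "Factorial_Ring.prime (card \<Gamma>)" "x \<in> \<Gamma>" "x \<noteq> id" "y \<in> \<Gamma>"
  shows "\<exists>i. y = x ^^ i"
proof -
  interpret group "perm_monoid \<Gamma>" by (rule group)
  have fin: "finite (carrier (perm_monoid \<Gamma>))" using finite_group by simp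
  have "ord x dvd card \<Gamma>" using ord_dvd_group_order[of x] assms(2) by simp
  moreover have "ord x \<noteq> 1" using ord_eq_1[of x] assms by simp
  ultimately have o: "ord x = card \<Gamma>" using assms(1) by (metis prime_nat_iff)
  let ?S = "{x [^]\<^bsub>perm_monoid \<Gamma>\<^esub> i |i. i \<in> {0..ord x - 1}}"
  have "?S \<subseteq> \<Gamma>" using assms(2) funpow_mem by auto
  moreover have "card ?S = ord x"
  proof -
    have "?S = (\<lambda>i. x [^]\<^bsub>perm_monoid \<Gamma>\<^esub> i) ` {0..ord x - 1}" by auto
    moreover have "inj_on (\<lambda>i. x [^]\<^bsub>perm_monoid \<Gamma>\<^esub> i) {0..ord x - 1}"
      using ord_inj[of x] assms(2) by simp
    ultimately have "card ?S = card {0..ord x - 1}" by (simp add: card_image)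
    then show ?thesis using o card_pos by simp
  qed
  ultimately have "?S = \<Gamma>" using o finite_group by (intro card_subset_eq) auto
  then show ?thesis using assms(4) by auto
qed

end

section \<open>Groups of even permutations of 35 points\<close>

text \<open>An abstract form of conjugation on Sylow subgroups: a point is a Sylow subgroup and
  \<open>P a\<close> its permutation image. \<open>P_absorb\<close> says that \<open>P a\<close>
  contains all 17-elements of the stabilizer of \<open>a\<close>. The order of \<open>P a\<close> is
  only assumed to be a power of 17; that it equals 17 is proved in \<open>card_P\<close>.\<close>

locale sylow_perm_group = perm_group \<Omega> \<Gamma>
  for \<Omega> :: "'a set" and \<Gamma> +
  fixes P :: "'a \<Rightarrow> ('a \<Rightarrow> 'a) set"
  assumes card_points: "card \<Omega> = 35"
    and even: "g \<in> \<Gamma> \<Longrightarrow> evenperm g"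
    and P_group: "a \<in> \<Omega> \<Longrightarrow> perm_group \<Omega> (P a)"
    and P_subset: "a \<in> \<Omega> \<Longrightarrow> P a \<subseteq> \<Gamma>"
    and P_card: "a \<in> \<Omega> \<Longrightarrow> \<exists>k. card (P a) = 17 ^ k"
    and P_conj: "g \<in> \<Gamma> \<Longrightarrow> a \<in> \<Omega> \<Longrightarrow> p \<in> P a \<Longrightarrow> g \<circ> p \<circ> perm_inv g \<in> P (g a)"
    and P_fix: "a \<in> \<Omega> \<Longrightarrow> p \<in> P a \<Longrightarrow> p a = a"
    and P_move: "a \<in> \<Omega> \<Longrightarrow> b \<in> \<Omega> \<Longrightarrow> b \<noteq> a \<Longrightarrow> \<exists>p\<in>P a. p b \<noteq> b"
    and P_absorb: "g \<in> \<Gamma> \<Longrightarrow> a \<in> \<Omega> \<Longrightarrow> g a = a \<Longrightarrow> g ^^ (17 ^ j) = id \<Longrightarrow> g \<in> P a"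
begin

section \<open>Orbits of the groups \<open>P a\<close>\<close>

lemma prime_17: "Factorial_Ring.prime (17 :: nat)"
  by simp

lemma P_mem: "p \<in> P a \<Longrightarrow> a \<in> \<Omega> \<Longrightarrow> p \<in> \<Gamma>"
  using P_subset by blast

text \<open>The only fixed point of \<open>P a\<close> is \<open>a\<close>, so \<open>S\<close> is a
  union of orbits whose sizes are multiples of 17.\<close>

lemma P_dvd:
  assumes "a \<in> \<Omega>" "S \<subseteq> \<Omega>" "a \<notin> S" "\<And>p x. p \<in> P a \<Longrightarrow> x \<in> S \<Longrightarrow> p x \<in> S"
  shows "17 dvd card S"
proof -
  interpret Pa: perm_group \<Omega> "P a" using assms(1) by (rule P_group)
  obtain k where "card (P a) = 17 ^ k" using P_card assms(1) by blast
  then show ?thesis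
  proof (intro p_group_dvd_card[OF acts_on_subset[OF Pa.acts assms(2)]])
    fix x assume x: "x \<in> S"
    then have "x \<in> \<Omega>" "x \<noteq> a" using assms by auto
    then show "\<exists>p\<in>carrier (perm_monoid (P a)). p x \<noteq> x" using P_move assms(1) by simp
  qed (use assms finite_points prime_17 in \<open>auto intro: finite_subset\<close>)
qed

definition orb :: "'a \<Rightarrow> 'a \<Rightarrow> 'a set" where
  "orb a b = (\<lambda>p. p b) ` P a"

text \<open>The order of an element of \<open>P a\<close> is a power of 17, so
  \<open>P_absorb\<close> puts it into \<open>P b\<close> as soon as it fixes
  \<open>b\<close>.\<close>

lemma inter_eq:
  assumes "a \<in> \<Omega>" "b \<in> \<Omega>"
  shows "{p \<in> P a. p b = b} = P a \<inter> P b"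
proof -
  have "p \<in> P b" if "p \<in> P a" "p b = b" for p
  proof -
    obtain k where "card (P a) = 17 ^ k" using P_card assms(1) by blast
    then have "p ^^ (17 ^ k) = id"
      using perm_group.p_group_funpow[OF P_group] assms(1) that(1) by blast
    then show ?thesis using P_absorb P_mem assms that by blast
  qed
  then show ?thesis using P_fix assms by blast
qed

lemma inter_group:
  assumes "a \<in> \<Omega>" "b \<in> \<Omega>"
  shows "perm_group \<Omega> (P a \<inter> P b)"
  using P_group[OF assms(1)] P_group[OF assms(2)] by (auto simp: perm_group_def)

lemma orb_self: "a \<in> \<Omega> \<Longrightarrow> b \<in> orb a b"
  unfolding orb_def using perm_group.id_mem[OF P_group]
  by (intro image_eqI[where x = id]) auto

lemma orb_subset:
  assumes "a \<in> \<Omega>" "b \<in> \<Omega>" "b \<noteq> a"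
  shows "orb a b \<subseteq> \<Omega> - {a}"
proof -
  have "p b \<in> \<Omega> - {a}" if "p \<in> P a" for p
    using assms that P_fix[of a p] apply_eq_iff[of p b a] P_mem[of p a] by auto
  then show ?thesis unfolding orb_def by blast
qed

lemma orb_closed:
  assumes "a \<in> \<Omega>" "p \<in> P a"
  shows "p x \<in> orb a b \<longleftrightarrow> x \<in> orb a b"
proof -
  interpret Pa: perm_group \<Omega> "P a" using assms(1) by (rule P_group)
  have *: "q x \<in> orb a b" if "q \<in> P a" "x \<in> orb a b" for q x
  proof -
    from that(2) obtain r where r: "r \<in> P a" "x = r b" by (auto simp: orb_def)
    then have "q x = (q \<circ> r) b" "q \<circ> r \<in> P a" using Pa.comp_mem that(1) by auto
    then show ?thesis unfolding orb_def by blast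
  qed
  show ?thesis
    using *[OF assms(2)] *[OF Pa.inv_mem[OF assms(2)], of "p x"] Pa.inv_apply[OF assms(2)] by auto
qed

lemma orb_eq:
  assumes "a \<in> \<Omega>" "c \<in> orb a b"
  shows "orb a c = orb a b"
proof -
  have *: "orb a c \<subseteq> orb a b" if "c \<in> orb a b" for b c
    using orb_closed[OF assms(1)] that unfolding orb_def[of a c] by blast
  obtain p where "p \<in> P a" "c = p b" using assms(2) by (auto simp: orb_def)
  then have "b \<in> orb a c"
    using orb_closed[OF assms(1), of p b c] orb_self[OF assms(1)] by simp
  then show ?thesis using * assms(2) by blast
qed

text \<open>The size is a positive power of 17 and at most 34.\<close>

lemma card_orb:
  assumes "a \<in> \<Omega>" "b \<in> \<Omega>" "b \<noteq> a"
  shows "card (orb a b) = 17"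
proof -
  interpret Pa: perm_group \<Omega> "P a" using assms(1) by (rule P_group)
  obtain k where k: "card (P a) = 17 ^ k" using P_card assms(1) by blast
  obtain p where "p \<in> P a" "p b \<noteq> b" using P_move assms by blast
  then obtain i where i: "i > 0" "card (orb a b) = 17 ^ i"
    using p_group_card_orbit[OF Pa.acts assms(2) prime_17, of k p] k by (auto simp: orb_def)
  have "card (orb a b) \<le> card (\<Omega> - {a})"
    using finite_points orb_subset assms by (intro card_mono) auto
  then have le: "(17::nat) ^ i \<le> 34" using i card_points assms(1) by simp
  have "i < 2"
  proof (rule ccontr)
    assume "\<not> i < 2"
    then have "(17::nat) ^ 2 \<le> 17 ^ i" by (intro power_increasing) auto
    then show False using le by simp
  qed
  then have "i = 1" using i by simp
  then show ?thesis using i by simp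
qed

text \<open>Two disjoint orbits of size 17 exhaust the 34 points other than
  \<open>a\<close>.\<close>

lemma orb_compl:
  assumes "a \<in> \<Omega>" "b \<in> \<Omega>" "b \<noteq> a" "c \<in> \<Omega>" "c \<noteq> a" "c \<notin> orb a b"
  shows "orb a c = \<Omega> - {a} - orb a b"
proof (rule card_subset_eq)
  show "finite (\<Omega> - {a} - orb a b)" using finite_points by simp
  have "orb a c \<inter> orb a b = {}"
    using orb_eq[OF assms(1)] orb_self[OF assms(1)] assms(6) by blast
  then show "orb a c \<subseteq> \<Omega> - {a} - orb a b"
    using orb_subset[of a c] assms by blast
  have "card (\<Omega> - {a} - orb a b) = card (\<Omega> - {a}) - card (orb a b)"
    using orb_subset[OF assms(1-3)] finite_points
    by (intro card_Diff_subset) (auto intro: finite_subset)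
  then show "card (orb a c) = card (\<Omega> - {a} - orb a b)"
    using card_orb[of a] assms card_points by simp
qed

lemma other_orb:
  assumes "a \<in> \<Omega>" "b \<in> \<Omega>" "b \<noteq> a"
  shows "\<exists>c\<in>\<Omega>. c \<noteq> a \<and> c \<notin> orb a b"
proof (rule ccontr)
  assume "\<not> ?thesis"
  then have "\<Omega> - {a} \<subseteq> orb a b" by blast
  moreover have "finite (orb a b)"
    using orb_subset[OF assms] finite_points by (auto intro: finite_subset)
  ultimately have "card (\<Omega> - {a}) \<le> card (orb a b)" by (intro card_mono) auto
  then show False using card_orb[OF assms] card_points assms(1) by simp
qed

lemma card_P_inter:
  assumes "a \<in> \<Omega>" "b \<in> \<Omega>" "b \<noteq> a"
  shows "card (P a) = 17 * card (P a \<inter> P b)"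
proof -
  interpret Pa: perm_group \<Omega> "P a" using assms(1) by (rule P_group)
  show ?thesis
    using Pa.card_orbit_stabilizer[OF assms(2)] card_orb[OF assms] inter_eq[OF assms(1,2)]
    by (simp add: orb_def)
qed

text \<open>\<open>P a \<inter> P b\<close> permutes the 16 points of \<open>orb a b\<close> other
  than \<open>b\<close>, but its nontrivial orbits have at least 17 points.\<close>

lemma inter_fixes_orb:
  assumes "a \<in> \<Omega>" "b \<in> \<Omega>" "b \<noteq> a" "p \<in> P a" "p \<in> P b" "c \<in> orb a b"
  shows "p c = c"
proof (rule ccontr)
  assume ne: "p c \<noteq> c"
  interpret Pa: perm_group \<Omega> "P a" using assms(1) by (rule P_group)
  interpret Q: perm_group \<Omega> "P a \<inter> P b" using assms(1,2) by (rule inter_group)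
  obtain k where k: "card (P a) = 17 ^ k" using P_card assms(1) by blast
  have "card (P a \<inter> P b) dvd 17 ^ k"
    using Pa.subgroup_card_dvd[OF Q.perm_group_axioms] k by simp
  then obtain j where j: "card (P a \<inter> P b) = 17 ^ j" using prime_17 divides_primepow_nat by blast
  have c: "c \<in> \<Omega>" using assms orb_subset by blast
  let ?O = "(\<lambda>q. q c) ` (P a \<inter> P b)"
  obtain i where i: "i > 0" "card ?O = 17 ^ i"
    using p_group_card_orbit[OF Q.acts c prime_17, of j p] j ne assms(4,5) by auto
  then have "17 \<le> card ?O" using power_increasing[of 1 i "17::nat"] by simp
  moreover have "c \<noteq> b" using ne assms P_fix by auto
  then have "?O \<subseteq> orb a b - {b}"
    using orb_closed[OF assms(1)] assms(6) P_fix[OF assms(2)] Q.apply_eq_iff by fastforce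
  moreover have fin: "finite (orb a b)"
    using orb_subset[OF assms(1-3)] finite_points by (auto intro: finite_subset)
  ultimately have "17 \<le> card (orb a b - {b})"
    by (meson card_mono finite_Diff le_trans)
  then show False using card_orb[OF assms(1-3)] orb_self[OF assms(1), of b] fin by simp
qed

text \<open>Suppose the \<Gamma>-orbit of \<open>a\<close> misses \<open>b\<close>. Then
  \<open>P b\<close> has no fixed point in it, so 17 divides its size; but \<open>P a\<close> fixes
  just one point of it, so the size is 1 modulo 17.\<close>

lemma transitive:
  assumes "a \<in> \<Omega>" "b \<in> \<Omega>"
  shows "\<exists>g\<in>\<Gamma>. g a = b"
proof (rule ccontr)
  assume no: "\<not> ?thesis"
  let ?O = "(\<lambda>g. g a) ` \<Gamma>"
  have O: "?O \<subseteq> \<Omega>" using assms(1) by auto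
  have cl: "p x \<in> ?O" if "p \<in> \<Gamma>" "x \<in> ?O" for p x
    using that comp_mem by (auto intro!: image_eqI[where x = "p \<circ> _"])
  have aO: "a \<in> ?O" by (intro image_eqI[where x = id]) auto
  have "17 dvd card ?O"
    by (rule P_dvd[OF assms(2) O]) (use no cl P_mem assms in auto)
  moreover have "17 dvd card (?O - {a})"
  proof (rule P_dvd[OF assms(1)])
    fix p x assume "p \<in> P a" "x \<in> ?O - {a}"
    then show "p x \<in> ?O - {a}"
      using cl[of p x] P_mem[of p a] P_fix[of a p] apply_eq_iff[of p x a] assms by auto
  qed (use O in auto)
  moreover have "card ?O = Suc (card (?O - {a}))"
    using aO finite_group by (intro card.remove) auto
  ultimately have "17 dvd Suc (card (?O - {a}))" "17 dvd card (?O - {a})" by simp_all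
  then show False by presburger
qed

text \<open>Conjugation by an element taking \<open>a\<close> to \<open>b\<close> embeds
  \<open>P a\<close> into \<open>P b\<close>; the converse inequality is symmetric.\<close>

lemma card_P_eq:
  assumes "a \<in> \<Omega>" "b \<in> \<Omega>"
  shows "card (P a) = card (P b)"
proof -
  have *: "card (P a) \<le> card (P b)" if ab: "a \<in> \<Omega>" "b \<in> \<Omega>" for a b
  proof -
    obtain g where g: "g \<in> \<Gamma>" "g a = b" using transitive ab by blast
    have "inj_on (\<lambda>p. g \<circ> p \<circ> perm_inv g) (P a)"
    proof (rule inj_onI)
      fix p q assume "g \<circ> p \<circ> perm_inv g = g \<circ> q \<circ> perm_inv g"
      then have "g (p (perm_inv g (g x))) = g (q (perm_inv g (g x)))" for x
        by (metis comp_apply)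
      then show "p = q" using g(1) by auto
    qed
    moreover have "(\<lambda>p. g \<circ> p \<circ> perm_inv g) ` P a \<subseteq> P b"
      using P_conj[OF g(1) ab(1)] g(2) by auto
    moreover have "finite (P b)" using P_subset[OF ab(2)] finite_group finite_subset by blast
    ultimately show ?thesis by (metis card_inj_on_le)
  qed
  show ?thesis using *[OF assms] *[OF assms(2,1)] by simp
qed

section \<open>Distinct groups \<open>P a\<close> and \<open>P b\<close> meet trivially\<close>

lemma finite_P: "a \<in> \<Omega> \<Longrightarrow> finite (P a)"
  using P_subset finite_group finite_subset by blast

text \<open>Both intersections have index 17 in \<open>P a\<close>, so inclusion forces equality.
  Geometrically, \<open>c\<close> lies on the line through \<open>a\<close> and
  \<open>b\<close>.\<close>

lemma collinear:
  assumes "a \<in> \<Omega>" "b \<in> \<Omega>" "c \<in> \<Omega>" "b \<noteq> a" "c \<noteq> a" "\<And>p. p \<in> P a \<inter> P b \<Longrightarrow> p c = c"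
  shows "P a \<inter> P b = P a \<inter> P c"
proof (rule card_subset_eq)
  show "finite (P a \<inter> P c)" using finite_P assms(1) by simp
  show "P a \<inter> P b \<subseteq> P a \<inter> P c" using assms inter_eq[of a c] by blast
  show "card (P a \<inter> P b) = card (P a \<inter> P c)"
    using card_P_inter[of a b] card_P_inter[of a c] assms by simp
qed

text \<open>Otherwise the intersection would fix both nontrivial orbits of \<open>P a\<close>
  pointwise and be trivial.\<close>

lemma inter_moves:
  assumes "a \<in> \<Omega>" "b \<in> \<Omega>" "b \<noteq> a" "P a \<inter> P b \<noteq> {id}"
    and "c \<in> \<Omega>" "c \<noteq> a" "c \<notin> orb a b"
  shows "P a \<inter> P b \<noteq> P a \<inter> P c"
proof
  assume eq: "P a \<inter> P b = P a \<inter> P c"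
  have "p = id" if p: "p \<in> P a" "p \<in> P b" for p
  proof (rule perm_eqI)
    fix x assume x: "x \<in> \<Omega>"
    have pc: "p \<in> P c" using p eq by blast
    consider "x = a" | "x \<in> orb a b" | "x \<in> orb a c"
      using orb_compl[OF assms(1-3,5-7)] x by blast
    then show "p x = id x"
      using inter_fixes_orb[of a _ p x] p pc assms P_fix by cases auto
  qed (use p assms P_mem in auto)
  moreover have "id \<in> P a \<inter> P b" using assms perm_group.id_mem[OF P_group] by blast
  ultimately show False using assms(4) by blast
qed

text \<open>If distinct \<open>P a\<close>, \<open>P b\<close> met nontrivially, the fixed-point sets of these intersections would
  be the lines of a linear space on 35 points with all lines of size 18, which is absurd because two
  such lines through a point already cover everything.\<close>

lemma P_inter_trivial:
  assumes "a \<in> \<Omega>" "b \<in> \<Omega>" "b \<noteq> a"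
  shows "P a \<inter> P b = {id}"
proof (rule ccontr)
  assume nt: "P a \<inter> P b \<noteq> {id}"
  \<comment> \<open>All \<open>P x\<close> have the same order and all intersections have index 17,
    so one nontrivial intersection makes all of them nontrivial.\<close>
  have nt': "P x \<inter> P y \<noteq> {id}" if "x \<in> \<Omega>" "y \<in> \<Omega>" "x \<noteq> y" for x y
  proof
    assume "P x \<inter> P y = {id}"
    then have "card (P a \<inter> P b) = 1"
      using card_P_inter[of x y] card_P_inter[of a b] card_P_eq[of a x] that assms by simp
    moreover have "id \<in> P a \<inter> P b" using assms perm_group.id_mem[OF P_group] by blast
    ultimately show False using nt by (metis card_1_singletonE singletonD)
  qed
  have line: "P x \<inter> P y = P x \<inter> P z"
    if "x \<in> \<Omega>" "y \<in> \<Omega>" "y \<noteq> x" "z \<in> orb x y" for x y z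
    using that orb_subset[of x y] inter_fixes_orb[of x y _ z] by (intro collinear) auto
  have not_line: "P x \<inter> P y \<noteq> P x \<inter> P z"
    if "x \<in> \<Omega>" "y \<in> \<Omega>" "y \<noteq> x" "z \<in> \<Omega>" "z \<noteq> x" "z \<notin> orb x y" for x y z
    using that nt'[of x y] by (intro inter_moves) auto
  obtain c where c: "c \<in> \<Omega>" "c \<noteq> a" "c \<notin> orb a b" using other_orb assms by blast
  have bc: "b \<noteq> c" using c orb_self assms by blast
  have c_b: "b \<notin> orb a c" using c orb_compl[of a b c] orb_self[of a b] assms by auto
  \<comment> \<open>\<open>c\<close> was chosen off the line through \<open>a\<close> and
    \<open>b\<close>, so the three points are not collinear.\<close>
  have a_bc: "a \<notin> orb b c"
  proof
    assume "a \<in> orb b c"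
    then have e: "P b \<inter> P c = P b \<inter> P a" using line[of b c a] assms c bc by simp
    then have "p c = c" if "p \<in> P a \<inter> P b" for p using that P_fix c(1) by blast
    then have "P a \<inter> P b = P a \<inter> P c" using collinear[of a b c] assms c by blast
    then show False using not_line[of a b c] assms c by blast
  qed
  have "\<not> orb b c \<subseteq> {c}"
  proof
    assume "orb b c \<subseteq> {c}"
    then have "card (orb b c) \<le> card {c}" by (intro card_mono) auto
    then show False using card_orb[of b c] assms c bc by simp
  qed
  then obtain d where d: "d \<in> orb b c" "d \<noteq> c" by blast
  have d': "d \<in> \<Omega>" "d \<noteq> b" "d \<noteq> a" using d orb_subset[of b c] assms c bc a_bc by auto
  have bcd: "P b \<inter> P c = P b \<inter> P d" using line[of b c d] assms c bc d by simp
  \<comment> \<open>\<open>d\<close> is a third point on the line through \<open>b\<close> and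
    \<open>c\<close>. The lines from \<open>a\<close> through \<open>b\<close> and through
    \<open>c\<close> cover everything, so \<open>d\<close> is on one of them, and in either case
    \<open>a\<close>, \<open>b\<close>, \<open>c\<close> become collinear.\<close>
  show False
  proof (cases "d \<in> orb a b")
    case True
    then have "P a \<inter> P b = P a \<inter> P d" using line[of a b d] assms by simp
    then have "p d = d" if "p \<in> P b \<inter> P a" for p using that P_fix d' by blast
    then have "P b \<inter> P a = P b \<inter> P d" using collinear[of b a d] assms d' by blast
    then have "p c = c" if "p \<in> P a \<inter> P b" for p using that bcd P_fix c(1) by blast
    then have "P a \<inter> P b = P a \<inter> P c" using collinear[of a b c] assms c by blast
    then show False using not_line[of a b c] assms c by blast
  next
    case False
    then have "d \<in> orb a c" using orb_compl[of a b c] assms c d' by blast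
    then have "P a \<inter> P c = P a \<inter> P d" using line[of a c d] assms c by simp
    then have "p d = d" if "p \<in> P c \<inter> P a" for p using that P_fix d' by blast
    then have 1: "P c \<inter> P a = P c \<inter> P d" using collinear[of c a d] assms c d d' by blast
    have "p d = d" if "p \<in> P c \<inter> P b" for p using that bcd P_fix d' by blast
    then have "P c \<inter> P b = P c \<inter> P d" using collinear[of c b d] assms c d d' bc by blast
    then have "p b = b" if "p \<in> P a \<inter> P c" for p using that 1 P_fix assms by blast
    then have "P a \<inter> P c = P a \<inter> P b" using collinear[of a c b] assms c by blast
    then show False using not_line[of a c b] assms c c_b by blast
  qed
qed

lemma card_P:
  assumes "a \<in> \<Omega>"
  shows "card (P a) = 17"
proof -
  have "\<Omega> \<noteq> {a}" using card_points by auto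
  then obtain b where "b \<in> \<Omega>" "b \<noteq> a" using assms by blast
  then show ?thesis using card_P_inter[of a b] P_inter_trivial[of a b] assms by simp
qed

section \<open>Point stabilizers and the two nontrivial orbits of \<open>P a\<close>\<close>

lemma regular:
  assumes "a \<in> \<Omega>" "b \<in> \<Omega>" "b \<noteq> a" "p \<in> P a" "p b = b"
  shows "p = id"
  using inter_eq[of a b] P_inter_trivial[of a b] assms by blast

lemma P_generator:
  assumes "a \<in> \<Omega>" "p \<in> P a" "p \<noteq> id" "q \<in> P a"
  shows "\<exists>i. q = p ^^ i"
  using perm_group.prime_order_generator[OF P_group[OF assms(1)]] card_P[OF assms(1)] prime_17 assms
  by simp

lemma P_commute:
  assumes "a \<in> \<Omega>" "p \<in> P a" "q \<in> P a"
  shows "p \<circ> q = q \<circ> p"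
proof (cases "p = id")
  case False
  then obtain i where "q = p ^^ i" using P_generator assms by blast
  then show ?thesis by (auto simp: fun_eq_iff funpow_swap1)
qed simp

lemma P_funpow: "a \<in> \<Omega> \<Longrightarrow> p \<in> P a \<Longrightarrow> p ^^ 17 = id"
  using perm_group.funpow_card[OF P_group] card_P by metis

text \<open>For \<open>x\<close> other than \<open>a\<close>, write \<open>g x = p x\<close> with
  \<open>p\<close> in \<open>P a\<close>. By commutation \<open>g ^^ n\<close> and
  \<open>p ^^ n\<close> agree at \<open>x\<close> for all \<open>n\<close>; hence
  \<open>g ^^ 17 = id\<close> and \<open>P_absorb\<close> applies.\<close>

lemma centralizer_mem_P:
  assumes g: "g \<in> \<Gamma>" "a \<in> \<Omega>" "g a = a"
    and comm: "\<And>p. p \<in> P a \<Longrightarrow> g \<circ> p = p \<circ> g"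
    and orb: "\<And>b. b \<in> \<Omega> \<Longrightarrow> b \<noteq> a \<Longrightarrow> g b \<in> orb a b"
  shows "g \<in> P a"
proof -
  have "g ^^ 17 = id"
  proof (rule perm_eqI)
    fix x assume x: "x \<in> \<Omega>"
    show "(g ^^ 17) x = id x"
    proof (cases "x = a")
      case True
      have "(g ^^ n) a = a" for n by (induction n) (auto simp: g)
      then show ?thesis using True by simp
    next
      case False
      then obtain p where p: "p \<in> P a" "g x = p x" using orb x by (auto simp: orb_def)
      have pn: "p ^^ n \<in> P a" for n using perm_group.funpow_mem[OF P_group] g p by blast
      have "(g ^^ n) x = (p ^^ n) x" for n
      proof (induction n)
        case (Suc n)
        have "g ((p ^^ n) x) = (p ^^ n) (g x)" using comm[OF pn] by (metis comp_apply)
        then show ?case using Suc p by (simp add: funpow_swap1)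
      qed simp
      then show ?thesis using P_funpow g p by simp
    qed
  qed (use g funpow_mem in auto)
  then show ?thesis using P_absorb[of g a 1] g by simp
qed

text \<open>By \<open>P_conj\<close>, \<open>g\<close> normalizes \<open>P a\<close> and therefore
  permutes its orbits.\<close>

lemma stabilizer_orb:
  assumes "g \<in> \<Gamma>" "a \<in> \<Omega>" "g a = a" "x \<in> orb a b"
  shows "g x \<in> orb a (g b)"
proof -
  obtain p where p: "p \<in> P a" "x = p b" using assms(4) by (auto simp: orb_def)
  have "g x = (g \<circ> p \<circ> perm_inv g) (g b)" using p assms(1) by simp
  moreover have "g \<circ> p \<circ> perm_inv g \<in> P a" using P_conj assms p by metis
  ultimately show ?thesis unfolding orb_def by blast
qed

lemma stabilizer_inv:
  assumes "g \<in> \<Gamma>" "g a = a"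
  shows "perm_inv g a = a"
  using assms inv_apply(1) by metis

text \<open>Any permutation of the two nontrivial orbits has trivial square.\<close>

lemma stabilizer_square_orb:
  assumes "g \<in> \<Gamma>" "a \<in> \<Omega>" "g a = a" "b \<in> \<Omega>" "b \<noteq> a"
  shows "g (g b) \<in> orb a b"
proof (cases "g b \<in> orb a b")
  case True
  then show ?thesis using stabilizer_orb[OF assms(1-3) True] orb_eq[OF assms(2) True] by simp
next
  case False
  have ne: "g x \<noteq> a" if "x \<noteq> a" for x using that assms apply_eq_iff by metis
  show ?thesis
  proof (rule ccontr)
    assume "g (g b) \<notin> orb a b"
    then have "g (g b) \<in> orb a (g b)"
      using orb_compl[of a b "g b"] False assms ne by auto
    then have "perm_inv g (g (g b)) \<in> orb a (perm_inv g (g b))"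
      using stabilizer_orb[OF inv_mem[OF assms(1)] assms(2) stabilizer_inv[OF assms(1,3)]] by blast
    then show False using False assms(1) by simp
  qed
qed

text \<open>With only two nontrivial orbits, \<open>g\<close> preserves both or swaps them.\<close>

lemma stabilizer_orb_uniform:
  assumes "g \<in> \<Gamma>" "a \<in> \<Omega>" "g a = a" "b \<in> \<Omega>" "b \<noteq> a" "g b \<in> orb a b" "c \<in> \<Omega>" "c \<noteq> a"
  shows "g c \<in> orb a c"
proof (cases "c \<in> orb a b")
  case True
  then show ?thesis
    using stabilizer_orb[OF assms(1-3) True] orb_eq[OF assms(2) True] orb_eq[OF assms(2,6)] by simp
next
  case False
  have g': "perm_inv g \<in> \<Gamma>" "perm_inv g a = a" using assms inv_mem stabilizer_inv by auto
  have "b \<in> orb a (g b)" using orb_eq[OF assms(2,6)] orb_self assms by simp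
  from stabilizer_orb[OF g'(1) assms(2) g'(2) this]
  have inv_b: "perm_inv g b \<in> orb a b" using assms(1) by simp
  show ?thesis
  proof (rule ccontr)
    assume "g c \<notin> orb a c"
    moreover have "g c \<noteq> a" using assms apply_eq_iff by metis
    ultimately have "g c \<in> orb a b"
      using orb_compl[of a b c] False assms by auto
    from stabilizer_orb[OF g'(1) assms(2) g'(2) this]
    have "c \<in> orb a (perm_inv g b)" using assms(1) by simp
    then show False using False orb_eq[OF assms(2) inv_b] by simp
  qed
qed

section \<open>Involutions and their fixed points\<close>

definition invol :: "('a \<Rightarrow> 'a) set" where
  "invol = {t \<in> \<Gamma>. t \<circ> t = id \<and> t \<noteq> id}"

lemma invol_apply: "t \<in> invol \<Longrightarrow> t (t x) = x"
  unfolding invol_def by (metis (mono_tags, lifting) comp_apply id_apply mem_Collect_eq)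

lemma invol_mem: "t \<in> invol \<Longrightarrow> t \<in> \<Gamma>"
  by (simp add: invol_def)

text \<open>An involution swapping the two nontrivial orbits of \<open>P a\<close> would be a product of 17
  transpositions, hence odd.\<close>

lemma invol_orb:
  assumes t: "t \<in> invol" and a: "a \<in> \<Omega>" "t a = a" and b: "b \<in> \<Omega>" "b \<noteq> a"
  shows "t b \<in> orb a b"
proof (rule ccontr)
  assume no: "t b \<notin> orb a b"
  have t\<Gamma>: "t \<in> \<Gamma>" "t \<circ> t = id" using t by (auto simp: invol_def)
  have "t x \<noteq> x" if "x \<in> \<Omega>" "x \<noteq> a" for x
  proof
    assume "t x = x"
    then have "t x \<in> orb a x" using orb_self a(1) by simp
    then show False using stabilizer_orb_uniform[of t a x b] that t\<Gamma> a b no by blast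
  qed
  then have "{x. t x \<noteq> x} = \<Omega> - {a}" using a apply_outside[OF t\<Gamma>(1)] by auto
  then have "card {x. t x \<noteq> x} = 34" using a(1) card_points by simp
  then have "sign t = - 1"
    using sign_involution[OF finite_points permutes[OF t\<Gamma>(1)] t\<Gamma>(2)] by simp
  then show False using even[OF t\<Gamma>(1)] by (simp add: sign_def)
qed

lemma invol_orb_closed:
  assumes "t \<in> invol" "a \<in> \<Omega>" "t a = a" "b \<in> \<Omega>" "b \<noteq> a" "x \<in> orb a b"
  shows "t x \<in> orb a b"
  using stabilizer_orb[OF invol_mem] orb_eq[OF _ invol_orb] assms by metis

text \<open>The moved points pair off, but the orbit has odd size 17.\<close>

lemma invol_fixes_in_orb:
  assumes "t \<in> invol" "a \<in> \<Omega>" "t a = a" "b \<in> \<Omega>" "b \<noteq> a"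
  shows "\<exists>x\<in>orb a b. t x = x"
proof (rule ccontr)
  assume "\<not> ?thesis"
  then have eq: "{x \<in> orb a b. t x \<noteq> x} = orb a b" by blast
  have "even (card {x \<in> orb a b. t x \<noteq> x})"
  proof (rule even_card_not_fixed)
    show "finite (orb a b)" using finite_P assms by (simp add: orb_def)
  qed (use assms invol_orb_closed invol_apply in auto)
  then show False unfolding eq using card_orb[of a b] assms by simp
qed

text \<open>If \<open>p\<close> were not the identity, it would generate \<open>P a\<close>, so
  \<open>t\<close> would centralize \<open>P a\<close>. Having a fixed point in every orbit of
  \<open>P a\<close>, \<open>t\<close> would then fix everything.\<close>

lemma invol_not_commute:
  assumes t: "t \<in> invol" and a: "a \<in> \<Omega>" "t a = a" and p: "p \<in> P a" "t \<circ> p = p \<circ> t"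
  shows "p = id"
proof (rule ccontr)
  assume "p \<noteq> id"
  have comm: "t (q x) = q (t x)" if q: "q \<in> P a" for q x
  proof -
    obtain i where "q = p ^^ i" using P_generator[OF a(1) p(1) \<open>p \<noteq> id\<close> q] by blast
    moreover have "t ((p ^^ i) x) = (p ^^ i) (t x)"
      by (induction i) (use p(2) in \<open>auto simp: fun_eq_iff\<close>)
    ultimately show ?thesis by simp
  qed
  have "t = id"
  proof (rule perm_eqI)
    fix x assume x: "x \<in> \<Omega>"
    show "t x = id x"
    proof (cases "x = a")
      case False
      then obtain y where y: "y \<in> orb a x" "t y = y" using invol_fixes_in_orb t a x by blast
      then have "x \<in> orb a y" using orb_eq orb_self a(1) by metis
      then obtain q where "q \<in> P a" "x = q y" by (auto simp: orb_def)
      then show ?thesis using comm y(2) by simp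
    qed (use a in simp)
  qed (use t invol_mem in auto)
  then show False using t by (simp add: invol_def)
qed

text \<open>The product \<open>r\<close> of \<open>p\<close> and its conjugate under
  \<open>t\<close> commutes with \<open>t\<close>, because \<open>P a\<close> is abelian. So
  \<open>r\<close> is trivial, and the conjugate is the inverse of \<open>p\<close>.\<close>

lemma invol_inverts:
  assumes t: "t \<in> invol" and a: "a \<in> \<Omega>" "t a = a" and p: "p \<in> P a"
  shows "t (p x) = perm_inv p (t x)"
proof -
  have t\<Gamma>: "t \<in> \<Gamma>" and tt: "t (t x) = x" for x using t invol_mem invol_apply by auto
  interpret Pa: perm_group \<Omega> "P a" using a(1) by (rule P_group)
  have "perm_inv t = t" by (rule inv_equality) (simp_all add: tt)
  then have tpt: "t \<circ> p \<circ> t \<in> P a" using P_conj[OF t\<Gamma> a(1) p] a(2) by simp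
  define r where "r = p \<circ> (t \<circ> p \<circ> t)"
  have r: "r \<in> P a" using Pa.comp_mem p tpt by (simp add: r_def)
  have "t \<circ> r = (t \<circ> p \<circ> t) \<circ> p \<circ> t" by (simp add: r_def fun_eq_iff tt)
  also have "\<dots> = r \<circ> t" using P_commute[OF a(1) p tpt] by (simp add: r_def)
  finally have "r = id" using invol_not_commute t a r by blast
  then have "p (t (p (t (t x)))) = t x" unfolding r_def by (metis comp_apply id_apply)
  then show ?thesis using tt Pa.inv_apply(1)[OF p] by metis
qed

text \<open>Besides \<open>a\<close>, there is exactly one fixed point in each nontrivial orbit: if
  \<open>y\<close> and \<open>p y\<close> are both fixed, inversion shows that
  \<open>p \<circ> p\<close> fixes \<open>y\<close>, whence \<open>p = id\<close> by regularity and
  odd order.\<close>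

lemma invol_card_fixed:
  assumes t: "t \<in> invol" and a: "a \<in> \<Omega>" "t a = a"
  shows "card {x \<in> \<Omega>. t x = x} = 3"
proof -
  have "\<Omega> \<noteq> {a}" using card_points by auto
  then obtain b0 where b0: "b0 \<in> \<Omega>" "b0 \<noteq> a" using a(1) by blast
  obtain c0 where c0: "c0 \<in> \<Omega>" "c0 \<noteq> a" "c0 \<notin> orb a b0" using other_orb a b0 by blast
  obtain b where b: "b \<in> orb a b0" "t b = b" using invol_fixes_in_orb t a b0 by blast
  obtain c where c: "c \<in> orb a c0" "t c = c" using invol_fixes_in_orb t a c0 by blast
  have uniq: "x = y" if "y \<in> \<Omega>" "y \<noteq> a" "t y = y" "x \<in> orb a y" "t x = x" for x y
  proof -
    obtain p where p: "p \<in> P a" "x = p y" using \<open>x \<in> orb a y\<close> by (auto simp: orb_def)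
    interpret Pa: perm_group \<Omega> "P a" using a(1) by (rule P_group)
    have "p y = perm_inv p y" using invol_inverts[OF t a p(1), of y] that p by simp
    then have "(p \<circ> p) y = y" using Pa.inv_apply(2)[OF p(1)] by simp
    then have "p \<circ> p = id" using regular[of a y] that a Pa.comp_mem p by blast
    then have "p ^^ 2 = id" by (simp add: numeral_2_eq_2)
    then have "p = id"
      using Pa.funpow_coprime[OF p(1), of 2 17] P_funpow[OF a(1) p(1)] by simp
    then show ?thesis using p by simp
  qed
  have compl: "orb a c0 = \<Omega> - {a} - orb a b0" using orb_compl a b0 c0 by blast
  have bc: "b \<in> \<Omega>" "b \<noteq> a" "c \<in> \<Omega>" "c \<noteq> a" "b \<noteq> c"
    using b c compl orb_subset[of a b0] a b0 by auto
  have eq: "orb a b = orb a b0" "orb a c = orb a c0" using orb_eq a(1) b c by auto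
  have "{x \<in> \<Omega>. t x = x} = {a, b, c}"
  proof (intro Set.set_eqI iffI)
    fix x assume "x \<in> {x \<in> \<Omega>. t x = x}"
    then show "x \<in> {a, b, c}"
      using uniq[of b x] uniq[of c x] bc b c eq compl by blast
  qed (use a b c bc in auto)
  then show ?thesis using bc by simp
qed

text \<open>These involutions form the coset of \<open>P a\<close> given by \<open>t\<close>. The
  product of two of them centralizes \<open>P a\<close> and preserves its orbits, so it lies in
  \<open>P a\<close>; conversely \<open>t \<circ> p\<close> squares to the identity because
  \<open>t\<close> inverts \<open>p\<close>.\<close>

lemma card_invol_stabilizer:
  assumes t: "t \<in> invol" and a: "a \<in> \<Omega>" "t a = a"
  shows "card {s \<in> invol. s a = a} = 17"
proof -
  interpret Pa: perm_group \<Omega> "P a" using a(1) by (rule P_group)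
  have "{s \<in> invol. s a = a} = (\<lambda>p. t \<circ> p) ` P a"
  proof (intro Set.set_eqI iffI)
    fix s assume "s \<in> {s \<in> invol. s a = a}"
    then have s: "s \<in> invol" "s a = a" by auto
    have "t \<circ> s \<in> P a"
    proof (rule centralizer_mem_P)
      show "t \<circ> s \<in> \<Gamma>" using t s invol_mem comp_mem by blast
      fix p assume p: "p \<in> P a"
      have "perm_inv (perm_inv p) = p" using Pa.bij[OF p] by (rule inv_inv_eq)
      then show "t \<circ> s \<circ> p = p \<circ> (t \<circ> s)"
        using invol_inverts[OF s(1) a(1) s(2) p] invol_inverts[OF t a Pa.inv_mem[OF p]]
        by (simp add: fun_eq_iff)
    next
      fix b assume b: "b \<in> \<Omega>" "b \<noteq> a"
      then show "(t \<circ> s) b \<in> orb a b"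
        using invol_orb_closed[OF t a b] invol_orb[OF s(1) a(1) s(2) b] by simp
    qed (use a s in auto)
    moreover have "s = t \<circ> (t \<circ> s)" using invol_apply[OF t] by (simp add: fun_eq_iff)
    ultimately show "s \<in> (\<lambda>p. t \<circ> p) ` P a" by blast
  next
    fix s assume "s \<in> (\<lambda>p. t \<circ> p) ` P a"
    then obtain p where p: "p \<in> P a" "s = t \<circ> p" by blast
    have "t (p (t (p x))) = x" for x
      using invol_inverts[OF t a p(1), of "t (p x)"] invol_apply[OF t] Pa.inv_apply[OF p(1)] by simp
    then have "s \<circ> s = id" using p(2) by auto
    moreover have "s \<noteq> id"
    proof
      \<comment> \<open>Then \<open>t\<close> would equal \<open>p\<close>, so its order would
        divide both 2 and 17.\<close>
      assume "s = id"
      then have "p x = t x" for x using p(2) invol_apply[OF t] by (metis comp_apply id_apply)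
      then have "p = t" by blast
      then have "t ^^ 17 = id" using P_funpow a p by simp
      moreover have "t ^^ 2 = id" using t by (simp add: invol_def numeral_2_eq_2)
      ultimately have "t = id" using funpow_coprime[OF invol_mem[OF t], of 17 2] by simp
      then show False using t by (simp add: invol_def)
    qed
    moreover have "s \<in> \<Gamma>" "s a = a"
      using p a comp_mem[OF invol_mem[OF t] P_mem[OF p(1) a(1)]] P_fix[OF a(1) p(1)] by simp_all
    ultimately show "s \<in> {s \<in> invol. s a = a}" by (simp add: invol_def)
  qed
  moreover have "inj_on (\<lambda>p. t \<circ> p) (P a)"
  proof (rule inj_onI)
    fix p q assume "t \<circ> p = t \<circ> q"
    then have "t (t (p x)) = t (t (q x))" for x by (metis comp_apply)
    then show "p = q" using invol_apply[OF t] by auto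
  qed
  ultimately show ?thesis using card_P[OF a(1)] by (simp add: card_image)
qed

lemma invol_empty: "invol = {}"
proof (rule ccontr)
  assume "invol \<noteq> {}"
  then obtain t where t: "t \<in> invol" by blast
  have fin: "finite invol" using finite_group by (simp add: invol_def)
  \<comment> \<open>An involution moves an even number of the 35 points.\<close>
  have fixed: "\<exists>a\<in>\<Omega>. s a = a" if s: "s \<in> invol" for s
  proof (rule ccontr)
    assume "\<not> ?thesis"
    then have "{x \<in> \<Omega>. s x \<noteq> x} = \<Omega>" by blast
    moreover have "even (card {x \<in> \<Omega>. s x \<noteq> x})"
      using finite_points invol_apply[OF s] invol_mem[OF s] by (intro even_card_not_fixed) auto
    ultimately show False using card_points by simp
  qed
  \<comment> \<open>By transitivity a conjugate of \<open>t\<close> fixes \<open>b\<close>, so the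
    count for a stabilizer applies at every point.\<close>
  have "card {s \<in> invol. s b = b} = 17" if b: "b \<in> \<Omega>" for b
  proof -
    obtain a where a: "a \<in> \<Omega>" "t a = a" using fixed t by blast
    obtain g where g: "g \<in> \<Gamma>" "g a = b" using transitive a b by blast
    let ?s = "g \<circ> t \<circ> perm_inv g"
    have "?s \<circ> ?s = id" using g invol_apply[OF t] by (simp add: fun_eq_iff)
    moreover have "?s \<noteq> id"
    proof
      assume "?s = id"
      then have "g (t (perm_inv g (g x))) = g x" for x by (metis comp_apply id_apply)
      then have "t x = x" for x using g by simp
      then show False using t by (auto simp: invol_def)
    qed
    moreover have "?s \<in> \<Gamma>" using g t invol_mem comp_mem inv_mem by metis
    moreover have "?s b = b" using g a by auto
    ultimately show ?thesis using card_invol_stabilizer[of ?s b] b by (simp add: invol_def)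
  qed
  then have "(\<Sum>b\<in>\<Omega>. card {s \<in> invol. s b = b}) = 35 * 17"
    using card_points by simp
  \<comment> \<open>The same pairs counted from the involutions: each has 3 fixed points.\<close>
  moreover have "(\<Sum>b\<in>\<Omega>. card {s \<in> invol. s b = b}) = 3 * card invol"
    by (rule sum_multicount) (use finite_points fin fixed invol_card_fixed in auto)
  ultimately have "3 * card invol = 595" by simp
  then show False by presburger
qed

section \<open>Odd order and the point stabilizers\<close>

lemma odd_card: "odd (card \<Gamma>)"
proof
  assume "even (card \<Gamma>)"
  then obtain t where "t \<in> \<Gamma>" "t \<noteq> id" "t ^^ 2 = id" using Cauchy[of 2] by auto
  then have "t \<in> invol" by (simp add: invol_def numeral_2_eq_2)
  then show False using invol_empty by simp
qed

text \<open>Since \<open>\<Gamma>\<close> has odd order, \<open>g\<close> is a 16th power; 16th powers preserve the orbits of \<open>P a\<close>, and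
  they centralize \<open>P a\<close> because its automorphism group has order 16.\<close>

lemma stabilizer_eq_P:
  assumes a: "a \<in> \<Omega>"
  shows "{g \<in> \<Gamma>. g a = a} = P a"
proof (intro Set.set_eqI iffI)
  interpret Pa: perm_group \<Omega> "P a" using a by (rule P_group)
  fix g assume "g \<in> {g \<in> \<Gamma>. g a = a}"
  then have g: "g \<in> \<Gamma>" "g a = a" by auto
  have "coprime 16 (card \<Gamma>)"
    using odd_card coprime_power_left_iff[of 2 4 "card \<Gamma>"] by simp
  \<comment> \<open>An inverse \<open>u\<close> of 16 modulo \<open>card \<Gamma>\<close> makes
    \<open>g ^^ u\<close> a 16th root of \<open>g\<close>.\<close>
  then obtain u v where uv: "16 * u = card \<Gamma> * v + 1"
    using bezout_nat[of 16 "card \<Gamma>"] by auto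
  define h where "h = g ^^ u"
  have h: "h \<in> \<Gamma>" using g funpow_mem by (simp add: h_def)
  have fix_pow: "(f ^^ n) a = a" if "f a = a" for f n using that by (induction n) auto
  have "h ^^ 16 = g ^^ (card \<Gamma> * v + 1)" using uv by (simp add: h_def funpow_mult mult.commute)
  also have "\<dots> = (g ^^ card \<Gamma>) ^^ v \<circ> g" by (simp only: funpow_add funpow_mult mult.commute) simp
  also have "\<dots> = g" using funpow_card[OF g(1)] by simp
  finally have gh: "g = h ^^ 16" ..
  show "g \<in> P a"
  proof (rule centralizer_mem_P[OF g(1) a g(2)])
    fix b assume b: "b \<in> \<Omega>" "b \<noteq> a"
    \<comment> \<open>As the square of \<open>h ^^ 8\<close>, \<open>g\<close> preserves both
      orbits.\<close>
    have "g b = (h ^^ 8) ((h ^^ 8) b)" using gh funpow_add[of 8 8 h] by simp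
    then show "g b \<in> orb a b"
      using stabilizer_square_orb[of "h ^^ 8" a b] b a funpow_mem[OF h] fix_pow[of h 8]
        fix_pow[of g u] g(2) by (simp add: h_def)
  next
    fix p assume p: "p \<in> P a"
    show "g \<circ> p = p \<circ> g"
    proof (cases "p = id")
      case False
      have "h a = a" using fix_pow[of g u] g(2) by (simp add: h_def)
      then have "h \<circ> p \<circ> perm_inv h \<in> P a" using P_conj[OF h a p] by simp
      then obtain r where "h \<circ> p \<circ> perm_inv h = p ^^ r" using P_generator[OF a p False] by blast
      then have hp: "h (p x) = (p ^^ r) (h x)" for x
        using inv_apply(1)[OF h] by (metis comp_apply)
      have hpi: "h ((p ^^ i) x) = (p ^^ (r * i)) (h x)" for i x
      proof (induction i arbitrary: x)
        case (Suc i)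
        have "h ((p ^^ Suc i) x) = h ((p ^^ i) (p x))" by (simp add: funpow_swap1)
        also have "\<dots> = (p ^^ (r * i)) ((p ^^ r) (h x))" using Suc hp by simp
        also have "\<dots> = (p ^^ (r * Suc i)) (h x)" by (metis add.commute comp_apply funpow_add mult_Suc_right)
        finally show ?case .
      qed simp
      \<comment> \<open>\<open>h\<close> conjugates \<open>p\<close> to \<open>p ^^ r\<close>, so
        \<open>h ^^ k\<close> conjugates it to \<open>p ^^ (r ^ k)\<close>.\<close>
      have hk: "(h ^^ k) (p x) = (p ^^ (r ^ k)) ((h ^^ k) x)" for k x
        by (induction k arbitrary: x) (simp_all add: hpi)
      have pmod: "(p ^^ m) x = (p ^^ (m mod 17)) x" for m x
        using funpow_mod_eq[of 17 p x m] P_funpow[OF a p] by simp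
      have "r mod 17 \<noteq> 0"
      proof
        assume "r mod 17 = 0"
        then have "h (p x) = h x" for x using hp[of x] pmod[of r] by simp
        then have "p x = x" for x using h by simp
        then show False using False by auto
      qed
      then have "\<not> 17 dvd r" by (simp add: dvd_eq_mod_eq_0)
      \<comment> \<open>By Fermat the exponent for \<open>k = 16\<close> is 1 modulo 17, so
        \<open>g\<close> commutes with \<open>p\<close>.\<close>
      from fermat_theorem[OF prime_17 this] have "r ^ 16 mod 17 = 1"
        by (simp add: cong_def)
      then have "g (p x) = p (g x)" for x using hk[of 16] pmod[of "r ^ 16"] gh by simp
      then show ?thesis by auto
    qed simp
  qed
qed (use a P_fix P_mem in auto)

section \<open>The order 595 and the elements of order 5 and 7\<close>

lemma card_group: "card \<Gamma> = 595"
proof -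
  have "\<Omega> \<noteq> {}" using card_points by auto
  then obtain a where a: "a \<in> \<Omega>" by blast
  have "(\<lambda>g. g a) ` \<Gamma> = \<Omega>" using transitive a by auto
  then show ?thesis
    using card_orbit_stabilizer[OF a] card_points stabilizer_eq_P[OF a] card_P[OF a] by simp
qed

text \<open>For prime \<open>q\<close> the order of such an element is exactly
  \<open>q\<close>.\<close>

definition elements_of_order :: "nat \<Rightarrow> ('a \<Rightarrow> 'a) set" where
  "elements_of_order q = {g \<in> \<Gamma>. g \<noteq> id \<and> g ^^ q = id}"

text \<open>The elements of order \<open>q\<close> come in pairs of mutually inverse ones, and conjugation by \<open>P a\<close>
  fixes none of them.\<close>

lemma card_elements_of_order:
  assumes q: "Factorial_Ring.prime q" "q dvd card \<Gamma>" "odd q" "coprime q 17"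
  shows "card (elements_of_order q) \<ge> 34"
proof -
  let ?E = "elements_of_order q"
  have fin: "finite ?E" using finite_group by (simp add: elements_of_order_def)
  have E: "g \<in> \<Gamma>" "g \<noteq> id" "g ^^ q = id" if "g \<in> ?E" for g
    using that by (auto simp: elements_of_order_def)
  have inv_inv: "perm_inv (perm_inv g) = g" if "g \<in> \<Gamma>" for g using bij[OF that] by (rule inv_inv_eq)
  have "even (card {g \<in> ?E. perm_inv g \<noteq> g})"
  proof (rule even_card_not_fixed[OF fin])
    fix g assume g: "g \<in> ?E"
    have "perm_inv g \<noteq> id" using inv_inv[of g] E[OF g] by (metis inv_id)
    moreover have "(perm_inv g) ^^ q = id"
      using inv_fn[OF bij[OF E(1)[OF g]], of q] E[OF g] by (metis inv_id)
    ultimately show "perm_inv g \<in> ?E" using E[OF g] inv_mem by (simp add: elements_of_order_def)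
  qed (use E inv_inv in auto)
  moreover have "{g \<in> ?E. perm_inv g \<noteq> g} = ?E"
  proof -
    \<comment> \<open>A self-inverse element has order dividing both 2 and the odd number
      \<open>q\<close>.\<close>
    have False if g: "g \<in> ?E" "perm_inv g = g" for g
    proof -
      have "g ^^ 2 = id" using inv_comp(1)[of g] E[OF g(1)] g(2) by (simp add: numeral_2_eq_2)
      then have "g = id" using funpow_coprime[of g 2 q] E[OF g(1)] q by simp
      then show False using E[OF g(1)] by simp
    qed
    then show ?thesis by blast
  qed
  ultimately have 2: "2 dvd card ?E" by simp
  have "\<Omega> \<noteq> {}" using card_points by auto
  then obtain a where a: "a \<in> \<Omega>" by blast
  interpret Pa: perm_group \<Omega> "P a" using a by (rule P_group)
  have conj_pow: "(p \<circ> g \<circ> perm_inv p) ^^ n = p \<circ> g ^^ n \<circ> perm_inv p" if "p \<in> \<Gamma>" for p g n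
    by (induction n) (use that in \<open>auto simp: fun_eq_iff\<close>)
  have conj_E: "p \<circ> g \<circ> perm_inv p \<in> ?E" if p: "p \<in> P a" and g: "g \<in> ?E" for p g
  proof -
    have p': "p \<in> \<Gamma>" using p a P_mem by blast
    have "p \<circ> g \<circ> perm_inv p \<noteq> id"
    proof
      assume "p \<circ> g \<circ> perm_inv p = id"
      then have "p (g (perm_inv p (p x))) = p x" for x by (metis comp_apply id_apply)
      then have "g x = x" for x using p' by simp
      then show False using E[OF g] by auto
    qed
    then show ?thesis
      using conj_pow[OF p', of q g] E[OF g] p' comp_mem inv_mem by (simp add: elements_of_order_def)
  qed
  have acts: "acts_on (perm_monoid (P a)) (\<lambda>p g. p \<circ> g \<circ> perm_inv p) ?E"
    unfolding acts_on_def
  proof (intro conjI ballI)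
    fix p r g assume "p \<in> carrier (perm_monoid (P a))" "r \<in> carrier (perm_monoid (P a))"
    then have "perm_inv (p \<circ> r) = perm_inv r \<circ> perm_inv p"
      using Pa.bij by (simp add: o_inv_distrib)
    then show "(p \<otimes>\<^bsub>perm_monoid (P a)\<^esub> r) \<circ> g \<circ> perm_inv (p \<otimes>\<^bsub>perm_monoid (P a)\<^esub> r)
        = p \<circ> (r \<circ> g \<circ> perm_inv r) \<circ> perm_inv p"
      by (simp add: comp_assoc)
  qed (use conj_E Pa.group in auto)
  have "17 dvd card ?E"
  proof (rule p_group_dvd_card[OF acts fin prime_17, of 1])
    fix g assume g: "g \<in> ?E"
    show "\<exists>p\<in>carrier (perm_monoid (P a)). p \<circ> g \<circ> perm_inv p \<noteq> g"
    proof (rule ccontr)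
      assume "\<not> ?thesis"
      then have "p \<circ> g \<circ> perm_inv p = g" if "p \<in> P a" for p using that by auto
      then have comm: "p (g x) = g (p x)" if "p \<in> P a" for p x
        using that Pa.inv_apply(1) by (metis comp_apply)
      \<comment> \<open>Commuting with \<open>P a\<close>, \<open>g\<close> sends \<open>a\<close>
        to another fixed point of \<open>P a\<close>, and \<open>a\<close> is the only one.\<close>
      have "g a = a"
      proof (rule ccontr)
        assume "g a \<noteq> a"
        then have "p = id" if "p \<in> P a" for p
          using regular[of a "g a" p] that comm[OF that, of a] P_fix[OF a that] a E[OF g] by simp
        then have "P a \<subseteq> {id}" by blast
        then have "card (P a) \<le> card {id :: 'a \<Rightarrow> 'a}" by (intro card_mono) auto
        then show False using card_P[OF a] by simp
      qed
      then have "g \<in> P a" using stabilizer_eq_P[OF a] E[OF g] by blast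
      then have "g = id" using funpow_coprime[of g q 17] P_funpow[OF a] E[OF g] q by blast
      then show False using E[OF g] by simp
    qed
  qed (use card_P[OF a] in simp)
  moreover have "card ?E > 0"
    using Cauchy[OF q(1,2)] fin by (auto simp: card_gt_0_iff elements_of_order_def)
  ultimately show ?thesis using 2 by presburger
qed

lemma contradiction: False
proof -
  let ?U = "\<Union>a\<in>\<Omega>. P a - {id}" and ?E = elements_of_order
  have "card ?U = (\<Sum>a\<in>\<Omega>. card (P a - {id}))"
  proof (rule card_UN_disjoint)
    show "\<forall>a\<in>\<Omega>. \<forall>b\<in>\<Omega>. a \<noteq> b \<longrightarrow> (P a - {id}) \<inter> (P b - {id}) = {}"
      using P_inter_trivial by blast
  qed (use finite_P finite_points in auto)
  also have "\<dots> = (\<Sum>a\<in>\<Omega>. 16)"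
  proof (rule sum.cong)
    fix a assume a: "a \<in> \<Omega>"
    then have "id \<in> P a" using perm_group.id_mem[OF P_group] by blast
    then show "card (P a - {id}) = 16" using a card_P[OF a] finite_P[OF a] by simp
  qed simp
  finally have U: "card ?U = 560" using card_points by simp
  have cop: "coprime 5 (7::nat)" "coprime 5 (17::nat)" "coprime 7 (17::nat)"
    by (simp_all add: primes_coprime)
  have E5: "card (?E 5) \<ge> 34"
    by (rule card_elements_of_order) (simp_all add: card_group cop)
  have E7: "card (?E 7) \<ge> 34"
    by (rule card_elements_of_order) (simp_all add: card_group cop)
  have sub: "?U \<union> (?E 5 \<union> ?E 7) \<subseteq> \<Gamma>" using P_subset by (auto simp: elements_of_order_def)
  have fin: "finite ?U" "finite (?E 5)" "finite (?E 7)"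
    by (rule finite_subset[OF _ finite_group], use sub in blast)+
  have "?E 5 \<inter> ?E 7 = {}"
    using funpow_coprime[OF _ _ _ cop(1)] by (auto simp: elements_of_order_def)
  moreover have "g \<notin> ?E 5 \<union> ?E 7" if "a \<in> \<Omega>" "g \<in> P a" for a g
    using that P_funpow[OF that] P_mem[of g a] funpow_coprime[OF _ _ _ cop(2), of g]
      funpow_coprime[OF _ _ _ cop(3), of g] unfolding elements_of_order_def by blast
  then have "?U \<inter> (?E 5 \<union> ?E 7) = {}" by blast
  ultimately have "card (?U \<union> (?E 5 \<union> ?E 7)) = card ?U + (card (?E 5) + card (?E 7))"
    using fin by (simp add: card_Un_disjoint)
  moreover have "card (?U \<union> (?E 5 \<union> ?E 7)) \<le> card \<Gamma>"
    using sub finite_group by (rule card_mono[rotated])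
  \<comment> \<open>The three disjoint sets have at least 560 + 34 + 34 = 628 elements.\<close>
  ultimately show False using U E5 E7 card_group by simp
qed

end
section \<open>Conjugation on the set of Sylow subgroups\<close>

lemma (in group) subgroup_pow_mem:
  assumes "subgroup H G" "h \<in> H"
  shows "h [^] (n::nat) \<in> H"
  using assms by (induction n) (auto intro: subgroup.one_closed subgroup.m_closed)

text \<open>\<open>H\<close> is normal in its normalizer, which contains \<open>h\<close>. The order
  of the quotient divides \<open>m\<close> and annihilates the coset of \<open>h\<close>.\<close>

lemma (in group) normalizing_power_mem:
  assumes "finite (carrier G)" "subgroup H G" "order G = card H * m"
    and h: "h \<in> carrier G" "h <# H #> inv h = H"
  shows "h [^] m \<in> H"
proof -
  have HG: "H \<subseteq> carrier G" using assms(2) by (rule subgroup.subset)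
  let ?N = "normalizer G H"
  have N: "subgroup ?N G" using HG by (rule normalizer_imp_subgroup)
  have hN: "h \<in> ?N" using h HG by (simp add: normalizer_def stabilizer_def)
  interpret N: group "G\<lparr>carrier := ?N\<rparr>" using N is_group by (rule subgroup.subgroup_is_group)
  interpret HN: normal H "G\<lparr>carrier := ?N\<rparr>" using assms(2) by (rule subgroup_in_normalizer)
  interpret F: group "G\<lparr>carrier := ?N\<rparr> Mod H" by (rule HN.factorgroup_is_group)
  have finN: "finite ?N" using subgroup.subset[OF N] assms(1) by (rule finite_subset)
  let ?c = "order (G\<lparr>carrier := ?N\<rparr> Mod H)"
  have "?c * card H = card ?N"
    using N.lagrange[OF HN.is_subgroup] by (simp add: order_def FactGroup_def)
  moreover have "card ?N dvd order G" using lagrange[OF N] by (metis dvd_triv_right)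
  moreover have "card H > 0"
    using subgroup.one_closed[OF assms(2)] finite_subset[OF HG assms(1)] by (auto simp: card_gt_0_iff)
  ultimately have "card H * ?c dvd card H * m" "card H > 0"
    using assms(3) by (simp_all add: mult.commute)
  then have "?c dvd m" by simp
  then obtain e where e: "m = ?c * e" ..
  have hN': "h \<in> carrier (G\<lparr>carrier := ?N\<rparr>)" using hN by simp
  have "(H #>\<^bsub>G\<lparr>carrier := ?N\<rparr>\<^esub> h) [^]\<^bsub>G\<lparr>carrier := ?N\<rparr> Mod H\<^esub> ?c = \<one>\<^bsub>G\<lparr>carrier := ?N\<rparr> Mod H\<^esub>"
    by (rule F.pow_order_eq_1) (use hN in \<open>auto simp: FactGroup_def RCOSETS_def\<close>)
  then have "H #>\<^bsub>G\<lparr>carrier := ?N\<rparr>\<^esub> (h [^]\<^bsub>G\<lparr>carrier := ?N\<rparr>\<^esub> ?c) = H"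
    using HN.FactGroup_pow[OF hN', of ?c] by (simp add: FactGroup_def)
  then have "h [^]\<^bsub>G\<lparr>carrier := ?N\<rparr>\<^esub> ?c \<in> H"
    using N.coset_join1 HN.subset HN.is_subgroup N.nat_pow_closed[OF hN'] by blast
  then have "h [^] ?c \<in> H" by (simp add: nat_pow_consistent[symmetric])
  then have "(h [^] ?c) [^] e \<in> H"
    using assms(2) by (rule subgroup_pow_mem[rotated])
  then show ?thesis using e h(1) by (simp add: nat_pow_pow)
qed

text \<open>By Bezout, \<open>h\<close> is a product of integral powers of the two given elements of
  \<open>H\<close>.\<close>

lemma (in group) coprime_power_mem:
  assumes "subgroup H G" "h \<in> carrier G" "h [^] (m::nat) \<in> H" "h [^] (n::nat) \<in> H" "coprime m n"
  shows "h \<in> H"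
proof (cases "m = 0")
  case True
  \<comment> \<open>Here coprimality forces \<open>n = 1\<close>.\<close>
  then show ?thesis using assms by simp
next
  case False
  then obtain x y where "m * x = n * y + 1" using bezout_nat[of m n] assms(5) by auto
  then have "(h [^] m) [^] x = (h [^] n) [^] y \<otimes> h"
    using assms(2) by (simp add: nat_pow_pow)
  then have "h = inv ((h [^] n) [^] y) \<otimes> (h [^] m) [^] x"
    using assms(2) by (simp add: m_assoc[symmetric])
  then show ?thesis
    using assms subgroup_pow_mem subgroup.m_closed subgroup.m_inv_closed by metis
qed

section \<open>Conjugates of a subgroup\<close>

lemma (in group) conj_eq_image:
  "g <# H #> inv g = (\<lambda>h. g \<otimes> h \<otimes> inv g) ` H"
  by (auto simp: l_coset_def r_coset_def)

lemma (in group) conj_mult: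
  assumes "g \<in> carrier G" "h \<in> carrier G" "H \<subseteq> carrier G"
  shows "(g \<otimes> h) <# H #> inv (g \<otimes> h) = g <# (h <# H #> inv h) #> inv g"
  unfolding conj_eq_image image_image
  by (rule image_cong) (use assms in \<open>auto simp: m_assoc inv_mult_group subsetD\<close>)

lemma (in group) conj_one: "H \<subseteq> carrier G \<Longrightarrow> \<one> <# H #> inv \<one> = H"
  unfolding conj_eq_image by (force simp: image_iff)

lemma (in group) conj_subgroup_self:
  assumes "subgroup H G" "h \<in> H"
  shows "h <# H #> inv h = H"
proof -
  have h: "h \<in> carrier G" using assms by (rule subgroup.mem_carrier)
  have *: "x <# H #> inv x \<subseteq> H" if "x \<in> H" for x
    using that assms(1) by (auto simp: conj_eq_image subgroup.m_closed subgroup.m_inv_closed)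
  \<comment> \<open>For the reverse inclusion, conjugate the inclusion for \<open>inv h\<close> by
    \<open>h\<close>.\<close>
  have "inv h <# H #> inv (inv h) \<subseteq> H" by (rule *) (rule subgroup.m_inv_closed[OF assms])
  then have "h <# (inv h <# H #> inv (inv h)) #> inv h \<subseteq> h <# H #> inv h"
    unfolding conj_eq_image by (rule image_mono)
  then have "H \<subseteq> h <# H #> inv h"
    using h conj_mult[of h "inv h" H] conj_one subgroup.subset[OF assms(1)] by simp
  then show ?thesis using * assms(2) by blast
qed

section \<open>The permutation action on the Sylow subgroups\<close>

locale sylow_action = group G for G (structure) +
  fixes p a m :: nat
  assumes fin: "finite (carrier G)"
    and p: "Factorial_Ring.prime p"
    and ord: "order G = p ^ a * m"
    and m: "\<not> p dvd m"
begin

definition sylows :: "'a set set" where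
  "sylows = {H. sylow_subgroup p H G}"

text \<open>The exponent of \<open>p\<close> in the group order is unique, so the exponent
  quantified in \<open>sylow_subgroup\<close> must be \<open>a\<close>.\<close>

lemma mem_sylows: "H \<in> sylows \<longleftrightarrow> subgroup H G \<and> card H = p ^ a"
proof -
  have "b = a" if "order G = p ^ b * n" "\<not> p dvd n" for b n
    using prime_power_cancel[OF p, of n b m a] that ord m by (simp add: mult.commute)
  then show ?thesis unfolding sylows_def sylow_subgroup_def using ord m by blast
qed

lemma finite_sylows: "finite sylows"
proof (rule finite_subset)
  show "sylows \<subseteq> Pow (carrier G)" using mem_sylows subgroup.subset by blast
qed (use fin in simp)

lemma conj_sylow:
  assumes "g \<in> carrier G" "H \<in> sylows"
  shows "g <# H #> inv g \<in> sylows"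
proof -
  have H: "subgroup H G" "card H = p ^ a" using assms(2) mem_sylows by auto
  have "inj_on (\<lambda>h. g \<otimes> h \<otimes> inv g) H"
    using conjugation_is_inj[OF assms(1)] subgroup.mem_carrier[OF H(1)] by (intro inj_onI) blast
  then have "card (g <# H #> inv g) = p ^ a" using H by (simp add: conj_eq_image card_image)
  then show ?thesis using subgroup_conjugation_is_surj2[OF assms(1) H(1)] mem_sylows by blast
qed

text \<open>The identity outside \<open>sylows\<close>, so that these are permutations in the sense of
  \<open>permutes\<close>.\<close>

definition act :: "'a \<Rightarrow> 'a set \<Rightarrow> 'a set" where
  "act g H = (if H \<in> sylows then g <# H #> inv g else H)"

lemma sylow_subset: "H \<in> sylows \<Longrightarrow> H \<subseteq> carrier G"
  using mem_sylows subgroup.subset by blast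

lemma act_mult:
  assumes "g \<in> carrier G" "h \<in> carrier G"
  shows "act (g \<otimes> h) = act g \<circ> act h"
  using assms conj_sylow sylow_subset by (auto simp: act_def fun_eq_iff conj_mult)

lemma act_one: "act \<one> = id"
  using sylow_subset conj_one by (auto simp: act_def fun_eq_iff)

lemma act_inv_apply:
  assumes "g \<in> carrier G"
  shows "act g (act (inv g) H) = H" "act (inv g) (act g H) = H"
  using act_mult[of g "inv g"] act_mult[of "inv g" g] act_one assms
  by (simp_all add: fun_eq_iff)

lemma perm_inv_act: "g \<in> carrier G \<Longrightarrow> perm_inv (act g) = act (inv g)"
  by (rule Hilbert_Choice.inv_equality) (simp_all add: act_inv_apply)

lemma act_pow: "g \<in> carrier G \<Longrightarrow> act (g [^] (n::nat)) = act g ^^ n"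
proof (induction n)
  case (Suc n)
  then show ?case using act_mult[of "g [^] n" g] by (simp add: funpow_Suc_right del: funpow.simps)
qed (simp add: act_one)

lemma act_mem: "g \<in> carrier G \<Longrightarrow> H \<in> sylows \<Longrightarrow> act g H \<in> sylows"
  using conj_sylow by (simp add: act_def)

lemma act_permutes:
  assumes "g \<in> carrier G"
  shows "act g permutes sylows"
proof (rule bij_imp_permutes)
  show "bij_betw (act g) sylows sylows"
    by (rule bij_betw_byWitness[where f' = "act (inv g)"])
      (use assms in \<open>auto simp: act_inv_apply act_mem\<close>)
qed (simp add: act_def)

lemma m_coprime: "coprime m (p ^ j)"
proof -
  have "coprime m p" using prime_imp_coprime[OF p m] by (simp add: coprime_commute)
  then show ?thesis by simp
qed

lemma sylow_power_mem:
  assumes "H \<in> sylows" "h \<in> carrier G" "act h H = H"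
  shows "h [^] m \<in> H"
  using normalizing_power_mem[of H m h] assms fin ord mem_sylows[of H] by (simp add: act_def)

lemma sylow_pow_eq_one:
  assumes "H \<in> sylows" "h \<in> H"
  shows "h [^] (p ^ a) = \<one>"
proof -
  have "subgroup H G" "card H = p ^ a" using assms(1) mem_sylows by auto
  then show ?thesis
    using group.pow_order_eq_1[OF subgroup.subgroup_is_group[OF _ is_group], of H h] assms(2)
    by (simp add: order_def nat_pow_consistent[symmetric])
qed

text \<open>An element of \<open>H\<close> normalizing \<open>K\<close> has its \<open>m\<close>-th
  power in \<open>K\<close>, and its \<open>p ^ a\<close>-th power is trivial; by coprimality it
  lies in \<open>K\<close>. So \<open>H\<close> has no fixed point other than itself.\<close>

lemma sylow_normalizes_imp_eq:
  assumes "H \<in> sylows" "K \<in> sylows" "\<And>h. h \<in> H \<Longrightarrow> act h K = K"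
  shows "H = K"
proof (rule card_subset_eq)
  show "finite K" using sylow_subset[OF assms(2)] fin by (rule finite_subset)
  show "card H = card K" using assms mem_sylows by simp
  have K: "subgroup K G" using assms(2) mem_sylows by blast
  show "H \<subseteq> K"
  proof
    fix h assume h: "h \<in> H"
    then have hG: "h \<in> carrier G" using sylow_subset assms(1) by blast
    show "h \<in> K"
      using coprime_power_mem[OF K hG, of m "p ^ a"] sylow_power_mem[OF assms(2) hG assms(3)[OF h]]
        sylow_pow_eq_one[OF assms(1) h] subgroup.one_closed[OF K] m_coprime by simp
  qed
qed

end

text \<open>The sign is 1 or -1, and its odd power \<open>n\<close> equals 1.\<close>

lemma evenperm_odd_order:
  assumes "permutation f" "f ^^ n = id" "odd n"
  shows "evenperm f"
proof -
  have "permutation (f ^^ k)" for k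
  proof (induction k)
    case (Suc k)
    then show ?case unfolding funpow.simps by (rule permutation_compose[OF assms(1)])
  qed simp
  then have "sign (f ^^ k) = sign f ^ k" for k
    by (induction k) (simp_all add: sign_compose assms(1))
  then have "sign f ^ n = 1" using assms(2) by (metis sign_id)
  then show ?thesis using assms(3) by (cases "evenperm f") (simp_all add: sign_def)
qed

text \<open>Passing to the even permutations keeps the whole image of each Sylow subgroup, since its
  elements have odd order.\<close>

lemma (in sylow_action) sylow_perm_group:
  assumes "p = 17" "card sylows = 35"
  shows "sylow_perm_group sylows {act g |g. g \<in> carrier G \<and> evenperm (act g)} (\<lambda>H. act ` H)"
    (is "sylow_perm_group _ ?\<Gamma> ?P")
proof -
  have perm: "permutation (act g)" if "g \<in> carrier G" for g
    using act_permutes[OF that] finite_sylows permutation_permutes by blast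
  have \<Gamma>: "perm_group sylows ?\<Gamma>"
  proof
    show "id \<in> ?\<Gamma>" using act_one[symmetric] by auto
    fix g assume "g \<in> ?\<Gamma>"
    then obtain x where x: "x \<in> carrier G" "evenperm (act x)" "g = act x" by blast
    then show "perm_inv g \<in> ?\<Gamma>"
      using perm_inv_act[OF x(1)] evenperm_inv[OF perm[OF x(1)]] by (auto intro!: exI[of _ "inv x"])
    fix h assume "h \<in> ?\<Gamma>"
    then obtain y where y: "y \<in> carrier G" "evenperm (act y)" "h = act y" by blast
    then show "g \<circ> h \<in> ?\<Gamma>"
      using x perm by (auto simp: evenperm_comp act_mult intro!: exI[of _ "x \<otimes> y"])
  qed (use finite_sylows act_permutes in auto)
  have P: "perm_group sylows (act ` H)" if H: "H \<in> sylows" for H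
  proof -
    have sub: "subgroup H G" using H mem_sylows by blast
    have HG: "h \<in> carrier G" if "h \<in> H" for h using sub that by (rule subgroup.mem_carrier)
    show ?thesis
    proof
      show "id \<in> act ` H" using act_one subgroup.one_closed[OF sub] by (metis imageI)
      fix g assume "g \<in> act ` H"
      then obtain x where x: "x \<in> H" "g = act x" by blast
      then show "perm_inv g \<in> act ` H"
        using perm_inv_act[OF HG[OF x(1)]] subgroup.m_inv_closed[OF sub] by auto
      fix h assume "h \<in> act ` H"
      then obtain y where y: "y \<in> H" "h = act y" by blast
      then have "g \<circ> h = act (x \<otimes> y)" using x HG act_mult by simp
      then show "g \<circ> h \<in> act ` H" using x y subgroup.m_closed[OF sub] by blast
    qed (use finite_sylows act_permutes HG in auto)
  qed
  show ?thesis
  proof (intro sylow_perm_group.intro sylow_perm_group_axioms.intro)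
    show "perm_group sylows ?\<Gamma>" by (rule \<Gamma>)
    show "card sylows = 35" by fact
    show "perm_group sylows (act ` H)" if "H \<in> sylows" for H using P that .
    show "act ` H \<subseteq> ?\<Gamma>" if H: "H \<in> sylows" for H
    proof
      fix f assume "f \<in> act ` H"
      then obtain x where x: "x \<in> H" "f = act x" by blast
      have xG: "x \<in> carrier G" using sylow_subset H x(1) by blast
      have "act x ^^ (p ^ a) = id"
        using act_pow[OF xG, of "p ^ a"] sylow_pow_eq_one[OF H x(1)] act_one by simp
      then have "evenperm (act x)"
        using evenperm_odd_order[OF perm[OF xG], of "p ^ a"] assms(1) by simp
      then show "f \<in> ?\<Gamma>" using x xG by blast
    qed
    show "\<exists>k. card (act ` H) = 17 ^ k" if H: "H \<in> sylows" for H
    proof -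
      interpret P: perm_group sylows "act ` H" using P H .
      have sub: "subgroup H G" using H mem_sylows by blast
      have HG: "h \<in> carrier G" if "h \<in> H" for h using sub that by (rule subgroup.mem_carrier)
      \<comment> \<open>The image of \<open>H\<close> is the orbit of \<open>id\<close> under left
        multiplication through \<open>act\<close>, so its size divides
        \<open>card H\<close>.\<close>
      have "acts_on (G\<lparr>carrier := H\<rparr>) (\<lambda>h f. act h \<circ> f) (act ` H)"
        using subgroup.subgroup_is_group[OF sub is_group] P.comp_mem HG
        by (auto simp: acts_on_def act_mult act_one comp_assoc)
      from orbit_stabilizer[OF this, of id]
      have "card ((\<lambda>h. act h \<circ> id) ` H) dvd card H"
        by (auto simp: order_def intro: dvdI[OF sym])
      then have "card (act ` H) dvd 17 ^ a" using H mem_sylows assms(1) by simp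
      then show ?thesis using divides_primepow_nat[of 17 _ a] p assms(1) by auto
    qed
    show "g \<circ> f \<circ> perm_inv g \<in> act ` g H"
      if g: "g \<in> ?\<Gamma>" and H: "H \<in> sylows" and f: "f \<in> act ` H" for g f H
    proof -
      obtain x h where x: "x \<in> carrier G" "g = act x" and h: "h \<in> H" "f = act h"
        using g f by blast
      have "h \<in> carrier G" using sylow_subset H h(1) by blast
      then have "g \<circ> f \<circ> perm_inv g = act (x \<otimes> h \<otimes> inv x)"
        using x h by (simp add: act_mult perm_inv_act)
      moreover have "x \<otimes> h \<otimes> inv x \<in> g H"
        using x h H by (auto simp: act_def conj_eq_image)
      ultimately show ?thesis by blast
    qed
    show "f H = H" if "H \<in> sylows" "f \<in> act ` H" for H f
      using that conj_subgroup_self mem_sylows by (auto simp: act_def)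
    show "\<exists>f\<in>act ` H. f K \<noteq> K" if "H \<in> sylows" "K \<in> sylows" "K \<noteq> H" for H K
      using sylow_normalizes_imp_eq[of H K] that by blast
    show "g \<in> act ` H"
      if g: "g \<in> ?\<Gamma>" and H: "H \<in> sylows" and gH: "g H = H" and gj: "g ^^ (17 ^ j) = id" for g H j
    proof -
      obtain x where x: "x \<in> carrier G" "g = act x" using g by blast
      have "x [^] m \<in> H" using sylow_power_mem[OF H x(1)] gH x(2) by simp
      moreover have "m \<noteq> 0" using m by (metis dvd_0_right)
      \<comment> \<open>Since \<open>m * u\<close> is 1 modulo \<open>17 ^ j\<close>,
        \<open>g\<close> is its own power with exponent \<open>m * u\<close>, the image of a power
        of \<open>x [^] m\<close>, which lies in \<open>H\<close>.\<close>
      then obtain u v where uv: "m * u = 17 ^ j * v + 1"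
        using bezout_nat[of m "17 ^ j"] m_coprime[of j] assms(1) by auto
      moreover have "g = g ^^ (m * u)"
      proof -
        have "g ^^ (m * u) = (g ^^ (17 ^ j)) ^^ v \<circ> g"
          unfolding uv by (simp only: funpow_add funpow_mult mult.commute) simp
        then show ?thesis using gj by simp
      qed
      then have "g = act ((x [^] m) [^] u)"
        using x act_pow by (simp add: nat_pow_pow)
      ultimately show ?thesis using subgroup_pow_mem H mem_sylows by blast
    qed
  qed auto
qed

theorem theoremA:
  shows "\<not> (\<exists>G :: ('a, 'b) monoid_scheme.
    group G \<and> finite (carrier G) \<and> card {H. sylow_subgroup 17 H G} = 35)"
proof
  assume "\<exists>G :: ('a, 'b) monoid_scheme.
    group G \<and> finite (carrier G) \<and> card {H. sylow_subgroup 17 H G} = 35"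
  then obtain G :: "('a, 'b) monoid_scheme"
    where G: "group G" "finite (carrier G)" "card {H. sylow_subgroup 17 H G} = 35" by blast
  \<comment> \<open>As 35 is not 0, some Sylow subgroup exists and supplies \<open>a\<close> and
    \<open>m\<close>.\<close>
  then have "{H. sylow_subgroup 17 H G} \<noteq> {}" by (intro notI) simp
  then obtain a m where am: "order G = 17 ^ a * m" "\<not> 17 dvd m"
    unfolding sylow_subgroup_def by blast
  interpret group G by (rule G(1))
  interpret sylow_action G 17 a m
    by unfold_locales (use G am in auto)
  show False
    using sylow_perm_group.contradiction[OF sylow_perm_group] G(3) by (simp add: sylows_def)
qed

end
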